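(* Let $R$ be a commutative ring with unit, let $\mathcal{A}$ be a set (alphabet), let $\mu:\mathcal{A}\times\mathcal{A}\to R$ be a mapping, and let $\mathcal{W}$ be the free $R$-module with basis the set of all words (including the empty word) in the alphabet $\mathcal{A}$. Let $\rho=\rho_\mu:\mathcal{W}\to\mathcal{W}\otimes\mathcal{W}$ be the $R$-linear map given on each word $w$ of length $m\ge0$ by $$\rho(w)=\sum_{1\le i<j\le m}\mu(w(i),w(j))\; w_{i+1,j}\otimes w_{1,i}w_{j+1,m+1}.$$ Then $\rho$ is a pre-Lie comultiplication in $\mathcal{W}$.
   Context: All tensor products are over $R$. A word of length $m\ge 0$ in the alphabet $\mathcal{A}$ is a finite sequence $w=w(1)w(2)\cdots w(m)$ of elements of $\mathcal{A}$; the word of length $0$ is the empty word. The concatenation of words $w,x$ is denoted $wx$. For a word $w$ of length $m\ge1$ and $1\le i\le j\le m+1$, set $w_{i,j}=w(i)w(i+1)\cdots w(j-1)$, a word of length $j-i$ (empty iff $i=j$). In particular $\rho(w)=0$ if $w$ has length $0$ or $1$. A comultiplication in an $R$-module $A$ is an $R$-linear map $\rho:A\to A\otimes A$; it is pre-Lie if $\tilde\rho=(\mathrm{id}_A\otimes\rho)\rho-(\rho\otimes\mathrm{id}_A)\rho$ satisfies $P^{1,2}\tilde\rho(a)=\tilde\rho(a)$ for all $a\in A$, where $P^{1,2}$ is the endomorphism of $A\otimes A\otimes A$ sending $a\otimes b\otimes c$ to $b\otimes a\otimes c$. *)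

theory Defs
  imports "HOL-Algebra.Module" "HOL-Algebra.AbelCoset"
begin

section \<open>Linear maps, submodules and quotients\<close>

text \<open>
  The library type of modules extends the record type of rings. The fields \<open>mult\<close> and \<open>one\<close>
  play no part in the locale \<^locale>\<open>module\<close>; they are left \<open>undefined\<close> below.
\<close>

definition linear_maps ::
  "('r, 's) ring_scheme \<Rightarrow> ('r, 'a, 'b) module_scheme \<Rightarrow> ('r, 'c, 'd) module_scheme \<Rightarrow> ('a \<Rightarrow> 'c) set"
  where "linear_maps R M N =
    {h \<in> carrier M \<rightarrow> carrier N.
      (\<forall>x\<in>carrier M. \<forall>y\<in>carrier M. h (x \<oplus>\<^bsub>M\<^esub> y) = h x \<oplus>\<^bsub>N\<^esub> h y) \<and>
      (\<forall>r\<in>carrier R. \<forall>x\<in>carrier M. h (r \<odot>\<^bsub>M\<^esub> x) = r \<odot>\<^bsub>N\<^esub> h x)}"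

definition generated_submodule ::
  "('r, 's) ring_scheme \<Rightarrow> ('r, 'a, 'b) module_scheme \<Rightarrow> 'a set \<Rightarrow> 'a set"
  where "generated_submodule R M S = \<Inter> {H. submodule H R M \<and> S \<subseteq> H}"

definition quotient_module ::
  "('r, 'a, 'b) module_scheme \<Rightarrow> 'a set \<Rightarrow> ('r, 'a set) module"
  where "quotient_module M H =
    \<lparr>carrier = a_rcosets\<^bsub>M\<^esub> H, mult = undefined, one = undefined,
     zero = H, add = set_add M,
     smult = (\<lambda>r C. \<Union>c\<in>C. H +>\<^bsub>M\<^esub> (r \<odot>\<^bsub>M\<^esub> c))\<rparr>"


section \<open>Free modules\<close>

text \<open>
  The free module with basis \<open>X\<close> consists of the finitely supported functions on \<open>X\<close>,
  extended by zero outside of \<open>X\<close>.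
\<close>

definition free_module :: "('r, 's) ring_scheme \<Rightarrow> 'x set \<Rightarrow> ('r, 'x \<Rightarrow> 'r) module"
  where "free_module R X =
    \<lparr>carrier = {f. (\<forall>x. f x \<in> carrier R) \<and> {x. f x \<noteq> \<zero>\<^bsub>R\<^esub>} \<subseteq> X \<and> finite {x. f x \<noteq> \<zero>\<^bsub>R\<^esub>}},
     mult = undefined, one = undefined,
     zero = (\<lambda>x. \<zero>\<^bsub>R\<^esub>), add = (\<lambda>f g x. f x \<oplus>\<^bsub>R\<^esub> g x),
     smult = (\<lambda>r f x. r \<otimes>\<^bsub>R\<^esub> f x)\<rparr>"

definition basis_vector :: "('r, 's) ring_scheme \<Rightarrow> 'x \<Rightarrow> 'x \<Rightarrow> 'r"
  where "basis_vector R x = (\<lambda>y. if y = x then \<one>\<^bsub>R\<^esub> else \<zero>\<^bsub>R\<^esub>)"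

text \<open>
  The linear map from a free module to \<open>P\<close> with value \<open>\<phi> x\<close> on the basis vector of \<open>x\<close>.
\<close>

definition linear_extension ::
  "('r, 's) ring_scheme \<Rightarrow> ('r, 'p, 'q) module_scheme \<Rightarrow> ('x \<Rightarrow> 'p) \<Rightarrow> ('x \<Rightarrow> 'r) \<Rightarrow> 'p"
  where "linear_extension R P \<phi> f = (\<Oplus>\<^bsub>P\<^esub>x\<in>{x. f x \<noteq> \<zero>\<^bsub>R\<^esub>}. f x \<odot>\<^bsub>P\<^esub> \<phi> x)"


section \<open>Tensor products\<close>

definition tensor_relations ::
  "('r, 's) ring_scheme \<Rightarrow> ('r, 'a, 'b) module_scheme \<Rightarrow> ('r, 'c, 'd) module_scheme \<Rightarrow> ('a \<times> 'c \<Rightarrow> 'r) set"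
  where "tensor_relations R M N =
    (let F = free_module R (carrier M \<times> carrier N); e = basis_vector R in
      {e (x \<oplus>\<^bsub>M\<^esub> x', y) \<ominus>\<^bsub>F\<^esub> (e (x, y) \<oplus>\<^bsub>F\<^esub> e (x', y)) | x x' y.
        x \<in> carrier M \<and> x' \<in> carrier M \<and> y \<in> carrier N} \<union>
      {e (x, y \<oplus>\<^bsub>N\<^esub> y') \<ominus>\<^bsub>F\<^esub> (e (x, y) \<oplus>\<^bsub>F\<^esub> e (x, y')) | x y y'.
        x \<in> carrier M \<and> y \<in> carrier N \<and> y' \<in> carrier N} \<union>
      {e (r \<odot>\<^bsub>M\<^esub> x, y) \<ominus>\<^bsub>F\<^esub> (r \<odot>\<^bsub>F\<^esub> e (x, y)) | r x y.
        r \<in> carrier R \<and> x \<in> carrier M \<and> y \<in> carrier N} \<union>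
      {e (x, r \<odot>\<^bsub>N\<^esub> y) \<ominus>\<^bsub>F\<^esub> (r \<odot>\<^bsub>F\<^esub> e (x, y)) | r x y.
        r \<in> carrier R \<and> x \<in> carrier M \<and> y \<in> carrier N})"

definition tensor_kernel ::
  "('r, 's) ring_scheme \<Rightarrow> ('r, 'a, 'b) module_scheme \<Rightarrow> ('r, 'c, 'd) module_scheme \<Rightarrow> ('a \<times> 'c \<Rightarrow> 'r) set"
  where "tensor_kernel R M N =
    generated_submodule R (free_module R (carrier M \<times> carrier N)) (tensor_relations R M N)"

definition tensor_product ::
  "('r, 's) ring_scheme \<Rightarrow> ('r, 'a, 'b) module_scheme \<Rightarrow> ('r, 'c, 'd) module_scheme
    \<Rightarrow> ('r, ('a \<times> 'c \<Rightarrow> 'r) set) module"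
  where "tensor_product R M N =
    quotient_module (free_module R (carrier M \<times> carrier N)) (tensor_kernel R M N)"

definition pure_tensor ::
  "('r, 's) ring_scheme \<Rightarrow> ('r, 'a, 'b) module_scheme \<Rightarrow> ('r, 'c, 'd) module_scheme
    \<Rightarrow> 'a \<Rightarrow> 'c \<Rightarrow> ('a \<times> 'c \<Rightarrow> 'r) set"
  where "pure_tensor R M N x y =
    tensor_kernel R M N +>\<^bsub>free_module R (carrier M \<times> carrier N)\<^esub> basis_vector R (x, y)"

text \<open>
  The linear map from a tensor product to \<open>P\<close> with value \<open>\<phi> x y\<close> on the pure tensor of \<open>x\<close> and
  \<open>y\<close>, for bilinear \<open>\<phi>\<close>. Bilinearity makes the linear extension of \<open>\<phi>\<close> constant on each coset,
  so that its image of a coset is a singleton.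
\<close>

definition tensor_lift ::
  "('r, 's) ring_scheme \<Rightarrow> ('r, 'p, 'q) module_scheme \<Rightarrow> ('a \<Rightarrow> 'c \<Rightarrow> 'p) \<Rightarrow> ('a \<times> 'c \<Rightarrow> 'r) set \<Rightarrow> 'p"
  where "tensor_lift R P \<phi> C = the_elem (linear_extension R P (case_prod \<phi>) ` C)"

text \<open>The map \<open>f \<otimes> g\<close>; the last two modules are the codomains of \<open>f\<close> and \<open>g\<close>.\<close>

definition tensor_map ::
  "('r, 's) ring_scheme \<Rightarrow> ('r, 'p, 'q) module_scheme \<Rightarrow> ('r, 't, 'u) module_scheme
    \<Rightarrow> ('a \<Rightarrow> 'p) \<Rightarrow> ('c \<Rightarrow> 't) \<Rightarrow> ('a \<times> 'c \<Rightarrow> 'r) set \<Rightarrow> ('p \<times> 't \<Rightarrow> 'r) set"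
  where "tensor_map R M N f g =
    tensor_lift R (tensor_product R M N) (\<lambda>x y. pure_tensor R M N (f x) (g y))"


section \<open>Pre-Lie comultiplications\<close>

text \<open>
  The threefold tensor product \<open>A \<otimes> A \<otimes> A\<close> is read as \<open>A \<otimes> (A \<otimes> A)\<close>; the module
  \<open>(A \<otimes> A) \<otimes> A\<close> is identified with it along \<open>(a \<otimes> b) \<otimes> c \<mapsto> a \<otimes> (b \<otimes> c)\<close>.
\<close>

abbreviation tensor_square ::
  "('r, 's) ring_scheme \<Rightarrow> ('r, 'a, 'b) module_scheme \<Rightarrow> ('r, ('a \<times> 'a \<Rightarrow> 'r) set) module"
  where "tensor_square R A \<equiv> tensor_product R A A"

abbreviation tensor_cube ::
  "('r, 's) ring_scheme \<Rightarrow> ('r, 'a, 'b) module_scheme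
    \<Rightarrow> ('r, ('a \<times> ('a \<times> 'a \<Rightarrow> 'r) set \<Rightarrow> 'r) set) module"
  where "tensor_cube R A \<equiv> tensor_product R A (tensor_square R A)"

definition pure_tensor3 ::
  "('r, 's) ring_scheme \<Rightarrow> ('r, 'a, 'b) module_scheme \<Rightarrow> 'a \<Rightarrow> 'a \<Rightarrow> 'a
    \<Rightarrow> ('a \<times> ('a \<times> 'a \<Rightarrow> 'r) set \<Rightarrow> 'r) set"
  where "pure_tensor3 R A a b c =
    pure_tensor R A (tensor_square R A) a (pure_tensor R A A b c)"

definition tensor_assoc ::
  "('r, 's) ring_scheme \<Rightarrow> ('r, 'a, 'b) module_scheme
    \<Rightarrow> (('a \<times> 'a \<Rightarrow> 'r) set \<times> 'a \<Rightarrow> 'r) set \<Rightarrow> ('a \<times> ('a \<times> 'a \<Rightarrow> 'r) set \<Rightarrow> 'r) set"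
  where "tensor_assoc R A =
    tensor_lift R (tensor_cube R A)
      (\<lambda>u c. tensor_lift R (tensor_cube R A) (\<lambda>a b. pure_tensor3 R A a b c) u)"

definition tensor_swap12 ::
  "('r, 's) ring_scheme \<Rightarrow> ('r, 'a, 'b) module_scheme
    \<Rightarrow> ('a \<times> ('a \<times> 'a \<Rightarrow> 'r) set \<Rightarrow> 'r) set \<Rightarrow> ('a \<times> ('a \<times> 'a \<Rightarrow> 'r) set \<Rightarrow> 'r) set"
  where "tensor_swap12 R A =
    tensor_lift R (tensor_cube R A)
      (\<lambda>a u. tensor_lift R (tensor_cube R A) (\<lambda>b c. pure_tensor3 R A b a c) u)"

text \<open>\<open>(id \<otimes> \<rho>) \<rho> - (\<rho> \<otimes> id) \<rho>\<close>\<close>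

definition coassociator ::
  "('r, 's) ring_scheme \<Rightarrow> ('r, 'a, 'b) module_scheme \<Rightarrow> ('a \<Rightarrow> ('a \<times> 'a \<Rightarrow> 'r) set)
    \<Rightarrow> 'a \<Rightarrow> ('a \<times> ('a \<times> 'a \<Rightarrow> 'r) set \<Rightarrow> 'r) set"
  where "coassociator R A \<rho> a =
    tensor_map R A (tensor_square R A) id \<rho> (\<rho> a) \<ominus>\<^bsub>tensor_cube R A\<^esub>
    tensor_assoc R A (tensor_map R (tensor_square R A) A \<rho> id (\<rho> a))"

locale comultiplication = module R A for R (structure) and A (structure) +
  fixes \<rho>
  assumes comult_linear: "\<rho> \<in> linear_maps R A (tensor_square R A)"

locale pre_lie_comultiplication = comultiplication +
  assumes pre_lie:
    "a \<in> carrier A \<Longrightarrow> tensor_swap12 R A (coassociator R A \<rho> a) = coassociator R A \<rho> a"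


section \<open>The comultiplication on words\<close>

definition word_module :: "('r, 's) ring_scheme \<Rightarrow> 'a set \<Rightarrow> ('r, 'a list \<Rightarrow> 'r) module"
  where "word_module R \<A> = free_module R (lists \<A>)"

text \<open>Positions in words are counted from 1, and \<open>subword w i j\<close> is \<open>w(i) \<dots> w(j - 1)\<close>.\<close>

definition letter :: "'a list \<Rightarrow> nat \<Rightarrow> 'a"
  where "letter w i = w ! (i - 1)"

definition subword :: "'a list \<Rightarrow> nat \<Rightarrow> nat \<Rightarrow> 'a list"
  where "subword w i j = map (letter w) [i..<j]"

definition word_comult_on_basis ::
  "('r, 's) ring_scheme \<Rightarrow> 'a set \<Rightarrow> ('a \<times> 'a \<Rightarrow> 'r) \<Rightarrow> 'a list
    \<Rightarrow> (('a list \<Rightarrow> 'r) \<times> ('a list \<Rightarrow> 'r) \<Rightarrow> 'r) set"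
  where "word_comult_on_basis R \<A> \<mu> w =
    (let W = word_module R \<A>; m = length w in
      finsum (tensor_square R W)
        (\<lambda>(i, j).
          \<mu> (letter w i, letter w j) \<odot>\<^bsub>tensor_square R W\<^esub>
            pure_tensor R W W
              (basis_vector R (subword w (i + 1) j))
              (basis_vector R (subword w 1 i @ subword w (j + 1) (m + 1))))
        {(i, j). 1 \<le> i \<and> i < j \<and> j \<le> m})"

definition word_comult ::
  "('r, 's) ring_scheme \<Rightarrow> 'a set \<Rightarrow> ('a \<times> 'a \<Rightarrow> 'r)
    \<Rightarrow> ('a list \<Rightarrow> 'r) \<Rightarrow> (('a list \<Rightarrow> 'r) \<times> ('a list \<Rightarrow> 'r) \<Rightarrow> 'r) set"
  where "word_comult R \<A> \<mu> =
    linear_extension R (tensor_square R (word_module R \<A>)) (word_comult_on_basis R \<A> \<mu>)"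

end

theory Submission
  imports Defs
begin

text \<open>
  Write \<open>\<rho>(w)\<close> as the sum of \<open>\<mu>(a, b) v \<otimes> uz\<close> over all splittings \<open>w = u a v b z\<close>. A summand of
  \<open>(id \<otimes> \<rho>) \<rho>(w)\<close> comes from a splitting of \<open>w\<close> followed by one of \<open>uz\<close>. The second pair of
  letters lies to the right of \<open>b\<close>, to the left of \<open>a\<close>, or encloses \<open>a\<close> and \<open>b\<close>. The enclosing
  terms are exactly those of \<open>(\<rho> \<otimes> id) \<rho>(w)\<close>, where the larger word is cut out first, and cancel.
  What remains are the two orders in which disjoint factors can be cut out of \<open>w\<close>; exchanging the
  orders exchanges the first two tensor factors.
\<close>

section \<open>Linear maps\<close>

text \<open>Deleting a factor renumbers the positions to its right, so iterating the formula with
  indices i < j would force case-dependent shifts. A splitting names the remaining pieces as words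
  instead; a second cut is then an equation between two concatenations, decided by where the seam of
  \<open>u @ z\<close> falls. Cancellation and symmetry are both bijections of summands: two cuts
  made in either order leave the same words, and since \<mu> sees only the two marked letters, the
  coefficients are the same two scalars in opposite order, which agree because \<open>R\<close> is
  commutative.

  The tensor product is a concrete quotient, and maps out of it are read off from representatives
  through \<open>the_elem\<close>, so no value of \<open>tensor_assoc\<close> or
  \<open>tensor_swap12\<close> is available before the underlying map is known to be bilinear. Both
  are nested lifts; hence the need for lifts that depend linearly on a parameter
  (\<open>tensor_lift_bilinear\<close>). With all maps linear, the identity has to be checked on
  single words only.\<close>

lemma linear_mapsI:
  assumes "\<And>x. x \<in> carrier M \<Longrightarrow> h x \<in> carrier N"
    and "\<And>x y. x \<in> carrier M \<Longrightarrow> y \<in> carrier M \<Longrightarrow> h (x \<oplus>\<^bsub>M\<^esub> y) = h x \<oplus>\<^bsub>N\<^esub> h y"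
    and "\<And>r x. r \<in> carrier R \<Longrightarrow> x \<in> carrier M \<Longrightarrow> h (r \<odot>\<^bsub>M\<^esub> x) = r \<odot>\<^bsub>N\<^esub> h x"
  shows "h \<in> linear_maps R M N"
  using assms by (auto simp: linear_maps_def)

lemma linear_mapsD:
  assumes "h \<in> linear_maps R M N" "x \<in> carrier M"
  shows "h x \<in> carrier N"
    and "y \<in> carrier M \<Longrightarrow> h (x \<oplus>\<^bsub>M\<^esub> y) = h x \<oplus>\<^bsub>N\<^esub> h y"
    and "r \<in> carrier R \<Longrightarrow> h (r \<odot>\<^bsub>M\<^esub> x) = r \<odot>\<^bsub>N\<^esub> h x"
  using assms by (auto simp: linear_maps_def)

lemma linear_maps_id: "id \<in> linear_maps R M M"
  by (simp add: linear_maps_def)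

lemma linear_maps_comp:
  assumes "f \<in> linear_maps R M N" "g \<in> linear_maps R N P"
  shows "(\<lambda>x. g (f x)) \<in> linear_maps R M P"
  by (rule linear_mapsI) (simp_all add: linear_mapsD[OF assms(1)] linear_mapsD[OF assms(2)])

lemma linear_maps_hom:
  assumes "module R M" "module R N" "h \<in> linear_maps R M N"
  shows "abelian_group_hom M N h"
proof -
  interpret M: module R M by fact
  interpret N: module R N by fact
  have "abelian_group M" "abelian_group N" by unfold_locales
  then show ?thesis
    by (intro abelian_group_homI group_hom.intro group_hom_axioms.intro M.a_group N.a_group)
       (use linear_mapsD[OF assms(3)] in \<open>auto simp: hom_def\<close>)
qed

lemma linear_maps_zero:
  assumes "module R M" "module R N" "h \<in> linear_maps R M N"
  shows "h \<zero>\<^bsub>M\<^esub> = \<zero>\<^bsub>N\<^esub>"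
  using abelian_group_hom.hom_zero[OF linear_maps_hom[OF assms]] .

lemma linear_maps_minus:
  assumes "module R M" "module R N" "h \<in> linear_maps R M N" "x \<in> carrier M" "y \<in> carrier M"
  shows "h (x \<ominus>\<^bsub>M\<^esub> y) = h x \<ominus>\<^bsub>N\<^esub> h y"
proof -
  interpret abelian_group_hom M N h by (rule linear_maps_hom[OF assms(1-3)])
  show ?thesis using assms(4,5) by (simp add: a_minus_def)
qed

lemma linear_maps_finsum:
  assumes "module R M" "module R N" "h \<in> linear_maps R M N" "f \<in> S \<rightarrow> carrier M"
  shows "h (\<Oplus>\<^bsub>M\<^esub>i\<in>S. f i) = (\<Oplus>\<^bsub>N\<^esub>i\<in>S. h (f i))"
proof -
  interpret M: module R M by fact
  interpret N: module R N by fact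
  note z = linear_maps_zero[OF assms(1-3)]
  note h = linear_mapsD[OF assms(3)]
  show ?thesis using assms(4)
  proof (induction S rule: infinite_finite_induct)
    case (insert x S)
    then have "f x \<in> carrier M" "f \<in> S \<rightarrow> carrier M" "(\<lambda>i. h (f i)) \<in> S \<rightarrow> carrier N"
      using h(1) by auto
    with insert show ?case by (simp add: h)
  \<comment> \<open>Empty and infinite index sets: both sums are zero, the infinite one by the
    default value of \<open>finsum\<close>, so preservation of zero settles both.\<close>
  qed (simp_all add: z)
qed

lemma linear_maps_diff:
  assumes "module R M" "module R N" "f \<in> linear_maps R M N" "g \<in> linear_maps R M N"
  shows "(\<lambda>x. f x \<ominus>\<^bsub>N\<^esub> g x) \<in> linear_maps R M N"
proof -
  interpret M: module R M by fact
  interpret N: module R N by fact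
  note fg = linear_mapsD[OF assms(3)] linear_mapsD[OF assms(4)]
  show ?thesis
    by (rule linear_mapsI)
       (simp_all add: fg a_minus_def N.smult_r_distr N.smult_r_minus N.minus_add N.a_ac)
qed

lemma linear_maps_add:
  assumes "module R M" "module R N" "f \<in> linear_maps R M N" "g \<in> linear_maps R M N"
  shows "(\<lambda>x. f x \<oplus>\<^bsub>N\<^esub> g x) \<in> linear_maps R M N"
proof -
  interpret M: module R M by fact
  interpret N: module R N by fact
  note fg = linear_mapsD[OF assms(3)] linear_mapsD[OF assms(4)]
  show ?thesis
    by (rule linear_mapsI) (simp_all add: fg N.smult_r_distr N.a_ac)
qed

lemma linear_maps_const_zero:
  assumes "module R N"
  shows "(\<lambda>x. \<zero>\<^bsub>N\<^esub>) \<in> linear_maps R M N"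
proof -
  interpret N: module R N by fact
  show ?thesis by (rule linear_mapsI) simp_all
qed

text \<open>Commutativity of \<open>R\<close> enters: \<open>r\<close> has to be moved past the
  scalar of the argument.\<close>

lemma linear_maps_smult:
  assumes "module R N" "r \<in> carrier R" "f \<in> linear_maps R M N"
  shows "(\<lambda>x. r \<odot>\<^bsub>N\<^esub> f x) \<in> linear_maps R M N"
proof -
  interpret N: module R N by fact
  note f = linear_mapsD[OF assms(3)]
  show ?thesis
    by (rule linear_mapsI)
       (simp_all add: f assms(2) N.smult_r_distr N.smult_assoc1[symmetric] N.R.m_comm)
qed

section \<open>Free modules\<close>

lemma module_free_module:
  assumes "cring R"
  shows "module R (free_module R X)"
proof -
  interpret cring R by fact
  show ?thesis
  proof (intro moduleI abelian_groupI, goal_cases)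
    \<comment> \<open>The cases treated by hand are closure under addition, existence of negatives
      and closure under scalars; there finiteness of the new support rests on an inclusion into the
      old ones.\<close>
    case (2 f g)
    have "{x. f x \<oplus>\<^bsub>R\<^esub> g x \<noteq> \<zero>\<^bsub>R\<^esub>} \<subseteq> {x. f x \<noteq> \<zero>\<^bsub>R\<^esub>} \<union> {x. g x \<noteq> \<zero>\<^bsub>R\<^esub>}" by auto
    with 2 show ?case
      by (auto simp: free_module_def intro: finite_subset)
  next
    case (7 f)
    have *: "{x. \<ominus>\<^bsub>R\<^esub> f x \<noteq> \<zero>\<^bsub>R\<^esub>} \<subseteq> {x. f x \<noteq> \<zero>\<^bsub>R\<^esub>}" by auto
    show ?case
      using 7 * by (intro bexI[of _ "\<lambda>x. \<ominus>\<^bsub>R\<^esub> f x"])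
        (auto simp: free_module_def l_neg intro: finite_subset)
  next
    case (8 r f)
    have *: "{x. r \<otimes>\<^bsub>R\<^esub> f x \<noteq> \<zero>\<^bsub>R\<^esub>} \<subseteq> {x. f x \<noteq> \<zero>\<^bsub>R\<^esub>}" using 8 by auto
    show ?case using 8 * by (auto simp: free_module_def intro: finite_subset)
  qed (use assms in \<open>auto simp: free_module_def a_ac l_distr r_distr m_assoc\<close>)
qed

lemma basis_vector_closed:
  assumes "cring R" "x \<in> X"
  shows "basis_vector R x \<in> carrier (free_module R X)"
proof -
  interpret cring R by fact
  \<comment> \<open>Only an inclusion, since over the zero ring the support is empty.\<close>
  have "{y. basis_vector R x y \<noteq> \<zero>\<^bsub>R\<^esub>} \<subseteq> {x}" by (auto simp: basis_vector_def)
  moreover from this have "finite {y. basis_vector R x y \<noteq> \<zero>\<^bsub>R\<^esub>}"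
    by (rule finite_subset) simp
  ultimately show ?thesis using \<open>x \<in> X\<close>
    by (auto simp: free_module_def) (simp add: basis_vector_def)
qed

text \<open>Induction on a finite set that merely contains the support: the coefficient at one point
  is split off as a multiple of a basis vector, and what is left vanishes there. If the coefficient
  is zero already, the induction hypothesis applies to \<open>f\<close> itself.\<close>

lemma free_module_induct [consumes 2, case_names zero add basis]:
  assumes "cring R" "f \<in> carrier (free_module R X)"
    and zero: "P (\<lambda>x. \<zero>\<^bsub>R\<^esub>)"
    and add: "\<And>f g. f \<in> carrier (free_module R X) \<Longrightarrow> g \<in> carrier (free_module R X)
      \<Longrightarrow> P f \<Longrightarrow> P g \<Longrightarrow> P (f \<oplus>\<^bsub>free_module R X\<^esub> g)"
    and basis: "\<And>r x. r \<in> carrier R \<Longrightarrow> x \<in> X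
      \<Longrightarrow> P (r \<odot>\<^bsub>free_module R X\<^esub> basis_vector R x)"
  shows "P f"
proof -
  interpret cring R by fact
  interpret F: module R "free_module R X" by (rule module_free_module[OF assms(1)])
  let ?supp = "\<lambda>f. {x. f x \<noteq> \<zero>\<^bsub>R\<^esub>}"
  have "P f" if "finite S" "f \<in> carrier (free_module R X)" "?supp f \<subseteq> S" for S f
    using that
  proof (induction S arbitrary: f rule: finite_induct)
    case empty
    then have "f = (\<lambda>x. \<zero>\<^bsub>R\<^esub>)" by auto
    then show ?case using zero by simp
  next
    case (insert a S f)
    note f = insert.prems
    have fx: "f x \<in> carrier R" for x using f by (simp add: free_module_def)
    show ?case
    proof (cases "f a = \<zero>\<^bsub>R\<^esub>")
      case True
      then have "?supp f \<subseteq> S" using f(2) by auto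
      then show ?thesis using f(1) by (rule insert.IH[rotated])
    next
      case False
      then have a: "a \<in> X" using f by (auto simp: free_module_def)
      define g where "g = (\<lambda>x. if x = a then \<zero>\<^bsub>R\<^esub> else f x)"
      have sg: "?supp g \<subseteq> ?supp f" "?supp g \<subseteq> S"
        using f(2) by (auto simp: g_def)
      have gx: "g x \<in> carrier R" for x using fx by (simp add: g_def)
      have "finite (?supp g)"
        using sg(1) by (rule finite_subset) (use f in \<open>simp add: free_module_def\<close>)
      moreover have "?supp g \<subseteq> X" using sg(1) f(1) by (auto simp: free_module_def)
      ultimately have g: "g \<in> carrier (free_module R X)"
        using gx by (simp add: free_module_def)
      have "f = (f a \<odot>\<^bsub>free_module R X\<^esub> basis_vector R a) \<oplus>\<^bsub>free_module R X\<^esub> g"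
        by (rule ext) (simp add: free_module_def basis_vector_def g_def fx)
      moreover have "P ((f a \<odot>\<^bsub>free_module R X\<^esub> basis_vector R a) \<oplus>\<^bsub>free_module R X\<^esub> g)"
        by (intro add F.smult_closed basis insert.IH g sg fx a basis_vector_closed assms(1))
      ultimately show ?thesis by simp
    qed
  qed
  moreover have "finite (?supp f)" using assms(2) by (simp add: free_module_def)
  ultimately show ?thesis using assms(2) by blast
qed

text \<open>The sum defining \<open>linear_extension\<close> runs over the support, which varies
  with \<open>f\<close>. Padding with zero terms brings several functions to a common index set, as
  additivity requires.\<close>

lemma linear_extension_eq_finsum:
  assumes "module R P" "f \<in> carrier (free_module R X)" "\<phi> \<in> X \<rightarrow> carrier P"
    and "finite S" "{x. f x \<noteq> \<zero>\<^bsub>R\<^esub>} \<subseteq> S" "S \<subseteq> X"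
  shows "linear_extension R P \<phi> f = (\<Oplus>\<^bsub>P\<^esub>x\<in>S. f x \<odot>\<^bsub>P\<^esub> \<phi> x)"
proof -
  interpret P: module R P by fact
  have fx: "f x \<in> carrier R" for x using assms(2) by (simp add: free_module_def)
  have "\<phi> x \<in> carrier P" if "x \<in> S" for x using assms(3,6) that by auto
  then show ?thesis
    unfolding linear_extension_def
    by (intro P.add.finprod_mono_neutral_cong_left) (use assms(4,5) fx in auto)
qed

lemma linear_extension_linear:
  assumes "module R P" "\<phi> \<in> X \<rightarrow> carrier P"
  shows "linear_extension R P \<phi> \<in> linear_maps R (free_module R X) P"
proof -
  interpret P: module R P by fact
  interpret F: module R "free_module R X" by (rule module_free_module) unfold_locales
  note eq = linear_extension_eq_finsum[OF assms(1) _ assms(2)]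
  show ?thesis
  proof (rule linear_mapsI)
    fix f assume f: "f \<in> carrier (free_module R X)"
    then show "linear_extension R P \<phi> f \<in> carrier P"
      unfolding linear_extension_def
      by (intro P.finsum_closed) (use assms(2) in \<open>auto simp: free_module_def\<close>)
    fix g assume g: "g \<in> carrier (free_module R X)"
    \<comment> \<open>This union also contains the support of the sum, which cancellation may have
      made smaller.\<close>
    define S where "S = {x. f x \<noteq> \<zero>\<^bsub>R\<^esub>} \<union> {x. g x \<noteq> \<zero>\<^bsub>R\<^esub>}"
    have S: "finite S" "S \<subseteq> X" using f g by (auto simp: S_def free_module_def)
    have c: "f x \<in> carrier R" "g x \<in> carrier R" for x using f g by (auto simp: free_module_def)
    have "linear_extension R P \<phi> (f \<oplus>\<^bsub>free_module R X\<^esub> g)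
      = (\<Oplus>\<^bsub>P\<^esub>x\<in>S. (f \<oplus>\<^bsub>free_module R X\<^esub> g) x \<odot>\<^bsub>P\<^esub> \<phi> x)"
      by (rule eq[OF F.a_closed[OF f g] S(1) _ S(2)]) (auto simp: S_def free_module_def)
    also have "\<dots> = (\<Oplus>\<^bsub>P\<^esub>x\<in>S. f x \<odot>\<^bsub>P\<^esub> \<phi> x \<oplus>\<^bsub>P\<^esub> g x \<odot>\<^bsub>P\<^esub> \<phi> x)"
      by (rule P.finsum_cong') (use S c assms(2) in \<open>auto simp: free_module_def P.smult_l_distr Pi_def subset_iff\<close>)
    also have "\<dots> = (\<Oplus>\<^bsub>P\<^esub>x\<in>S. f x \<odot>\<^bsub>P\<^esub> \<phi> x) \<oplus>\<^bsub>P\<^esub> (\<Oplus>\<^bsub>P\<^esub>x\<in>S. g x \<odot>\<^bsub>P\<^esub> \<phi> x)"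
      by (rule P.finsum_addf) (use S c assms(2) in \<open>auto simp: Pi_def subset_iff\<close>)
    also have "\<dots> = linear_extension R P \<phi> f \<oplus>\<^bsub>P\<^esub> linear_extension R P \<phi> g"
      using eq[OF f S(1) _ S(2)] eq[OF g S(1) _ S(2)] by (auto simp: S_def)
    finally show "linear_extension R P \<phi> (f \<oplus>\<^bsub>free_module R X\<^esub> g)
      = linear_extension R P \<phi> f \<oplus>\<^bsub>P\<^esub> linear_extension R P \<phi> g" .
  next
    fix r f assume r: "r \<in> carrier R" and f: "f \<in> carrier (free_module R X)"
    let ?S = "{x. f x \<noteq> \<zero>\<^bsub>R\<^esub>}"
    have S: "finite ?S" "?S \<subseteq> X" using f by (auto simp: free_module_def)
    have c: "f x \<in> carrier R" for x using f by (auto simp: free_module_def)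
    have "linear_extension R P \<phi> (r \<odot>\<^bsub>free_module R X\<^esub> f)
      = (\<Oplus>\<^bsub>P\<^esub>x\<in>?S. (r \<odot>\<^bsub>free_module R X\<^esub> f) x \<odot>\<^bsub>P\<^esub> \<phi> x)"
      by (rule eq[OF F.smult_closed[OF r f] S(1) _ S(2)]) (use r in \<open>auto simp: free_module_def\<close>)
    also have "\<dots> = (\<Oplus>\<^bsub>P\<^esub>x\<in>?S. r \<odot>\<^bsub>P\<^esub> (f x \<odot>\<^bsub>P\<^esub> \<phi> x))"
      by (rule P.finsum_cong') (use S c r assms(2) in \<open>auto simp: free_module_def P.smult_assoc1 Pi_def subset_iff\<close>)
    also have "\<dots> = r \<odot>\<^bsub>P\<^esub> linear_extension R P \<phi> f"
      unfolding linear_extension_def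
      by (rule P.finsum_smult_ldistr[symmetric]) (use S c r assms(2) in \<open>auto simp: Pi_def subset_iff\<close>)
    finally show "linear_extension R P \<phi> (r \<odot>\<^bsub>free_module R X\<^esub> f) = r \<odot>\<^bsub>P\<^esub> linear_extension R P \<phi> f" .
  qed
qed

lemma linear_extension_basis_vector:
  assumes "module R P" "\<phi> \<in> X \<rightarrow> carrier P" "x \<in> X"
  shows "linear_extension R P \<phi> (basis_vector R x) = \<phi> x"
proof -
  interpret P: module R P by fact
  have "cring R" by unfold_locales
  then have "linear_extension R P \<phi> (basis_vector R x) = (\<Oplus>\<^bsub>P\<^esub>y\<in>{x}. basis_vector R x y \<odot>\<^bsub>P\<^esub> \<phi> y)"
    by (intro linear_extension_eq_finsum[OF assms(1) basis_vector_closed[OF _ assms(3)] assms(2)])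
       (use assms in \<open>auto simp: basis_vector_def\<close>)
  also have "\<dots> = \<phi> x" using assms by (simp add: basis_vector_def Pi_def)
  finally show ?thesis .
qed

text \<open>This is what reduces the pre-Lie identity to basis vectors of words.\<close>

lemma linear_maps_eqI_basis:
  assumes "module R P" "f \<in> linear_maps R (free_module R X) P" "g \<in> linear_maps R (free_module R X) P"
    and "\<And>x. x \<in> X \<Longrightarrow> f (basis_vector R x) = g (basis_vector R x)"
    and "a \<in> carrier (free_module R X)"
  shows "f a = g a"
proof -
  interpret P: module R P by fact
  have R: "cring R" by (rule P.R.is_cring)
  note F = module_free_module[OF R, of X]
  show ?thesis using R assms(5)
  proof (induction rule: free_module_induct)
    case zero
    show ?case
      using linear_maps_zero[OF F assms(1,2)] linear_maps_zero[OF F assms(1,3)]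
      by (simp add: free_module_def)
  next
    case (add h k)
    then show ?case by (simp add: linear_mapsD(2)[OF assms(2)] linear_mapsD(2)[OF assms(3)])
  next
    case (basis r x)
    then show ?case
      by (simp add: linear_mapsD(3)[OF assms(2)] linear_mapsD(3)[OF assms(3)] assms(4)
          basis_vector_closed[OF R])
  qed
qed

section \<open>Quotient modules\<close>

lemma submodule_abelian_subgroup:
  assumes "module R M" "submodule H R M"
  shows "abelian_subgroup H M"
proof -
  interpret module R M by fact
  show ?thesis
    by (rule abelian_subgroupI2[OF M.a_comm_group submodule.axioms(1)[OF assms(2)]])
qed

lemma submodule_coset_eqI:
  assumes "module R M" "submodule H R M" "x \<in> carrier M" "y \<in> carrier M" "x \<ominus>\<^bsub>M\<^esub> y \<in> H"
  shows "H +>\<^bsub>M\<^esub> x = H +>\<^bsub>M\<^esub> y"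
proof -
  interpret abelian_subgroup H M by (rule submodule_abelian_subgroup[OF assms(1,2)])
  have "x \<in> H +>\<^bsub>M\<^esub> y" using assms(3-5) by (intro a_rcos_module_rev) (simp_all add: a_minus_def)
  then show ?thesis using a_repr_independence' assms(4) by blast
qed

lemma carrier_quotient_module:
  "carrier (quotient_module M H) = (\<lambda>x. H +>\<^bsub>M\<^esub> x) ` carrier M"
  by (auto simp: quotient_module_def A_RCOSETS_def RCOSETS_def a_r_coset_def)

lemma add_quotient_module:
  assumes "module R M" "submodule H R M" "x \<in> carrier M" "y \<in> carrier M"
  shows "(H +>\<^bsub>M\<^esub> x) \<oplus>\<^bsub>quotient_module M H\<^esub> (H +>\<^bsub>M\<^esub> y) = H +>\<^bsub>M\<^esub> (x \<oplus>\<^bsub>M\<^esub> y)"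
proof -
  interpret abelian_subgroup H M by (rule submodule_abelian_subgroup[OF assms(1,2)])
  show ?thesis using a_rcos_sum[OF assms(3,4)] by (simp add: quotient_module_def)
qed

text \<open>The scalar action on a coset is a union of cosets over all its representatives. Two
  representatives differ by an element of \<open>H\<close>, and \<open>H\<close> absorbs scalars, so
  all these cosets coincide.\<close>

lemma smult_quotient_module:
  assumes "module R M" "submodule H R M" "r \<in> carrier R" "x \<in> carrier M"
  shows "r \<odot>\<^bsub>quotient_module M H\<^esub> (H +>\<^bsub>M\<^esub> x) = H +>\<^bsub>M\<^esub> (r \<odot>\<^bsub>M\<^esub> x)"
proof -
  interpret abelian_subgroup H M by (rule submodule_abelian_subgroup[OF assms(1,2)])
  interpret module R M by fact
  have "H +>\<^bsub>M\<^esub> (r \<odot>\<^bsub>M\<^esub> c) = H +>\<^bsub>M\<^esub> (r \<odot>\<^bsub>M\<^esub> x)" if "c \<in> H +>\<^bsub>M\<^esub> x" for c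
  proof (rule submodule_coset_eqI[OF assms(1,2)])
    have c: "c \<in> carrier M" using a_elemrcos_carrier[OF assms(4) that] .
    have "c \<ominus>\<^bsub>M\<^esub> x \<in> H" using a_rcos_module_imp[OF assms(4) that] by (simp add: a_minus_def)
    then have "r \<odot>\<^bsub>M\<^esub> (c \<ominus>\<^bsub>M\<^esub> x) \<in> H" by (rule submodule.smult_closed[OF assms(2,3)])
    then show "r \<odot>\<^bsub>M\<^esub> c \<ominus>\<^bsub>M\<^esub> r \<odot>\<^bsub>M\<^esub> x \<in> H"
      using c assms(3,4) by (simp add: a_minus_def smult_r_distr smult_r_minus)
    show "r \<odot>\<^bsub>M\<^esub> c \<in> carrier M" "r \<odot>\<^bsub>M\<^esub> x \<in> carrier M" using c assms by simp_all
  qed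
  moreover have "x \<in> H +>\<^bsub>M\<^esub> x" by (rule a_rcos_self[OF assms(4)])
  ultimately have "(\<Union>c\<in>H +>\<^bsub>M\<^esub> x. H +>\<^bsub>M\<^esub> (r \<odot>\<^bsub>M\<^esub> c)) = H +>\<^bsub>M\<^esub> (r \<odot>\<^bsub>M\<^esub> x)"
    by (intro SUP_eq_const) blast+
  then show ?thesis by (simp add: quotient_module_def)
qed

lemma module_quotient_module:
  assumes "module R M" "submodule H R M"
  shows "module R (quotient_module M H)"
proof -
  interpret M: module R M by fact
  interpret H: abelian_subgroup H M by (rule submodule_abelian_subgroup[OF assms])
  let ?Q = "quotient_module M H"
  have carr: "carrier ?Q = {C. \<exists>x\<in>carrier M. C = H +>\<^bsub>M\<^esub> x}"
    by (auto simp: carrier_quotient_module)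
  have closed: "H +>\<^bsub>M\<^esub> x \<in> carrier ?Q" if "x \<in> carrier M" for x
    using that by (auto simp: carr)
  note [simp] = add_quotient_module[OF assms] smult_quotient_module[OF assms]
  \<comment> \<open>The zero of the quotient is given as \<open>H\<close> itself; written as a coset
    it falls under the rule for sums of cosets.\<close>
  have zero: "\<zero>\<^bsub>?Q\<^esub> = H +>\<^bsub>M\<^esub> \<zero>\<^bsub>M\<^esub>"
    using H.a_rcos_const[OF H.zero_closed] by (simp add: quotient_module_def)
  have *: "\<And>C. C \<in> carrier ?Q \<Longrightarrow> (\<And>x. x \<in> carrier M \<Longrightarrow> C = H +>\<^bsub>M\<^esub> x \<Longrightarrow> P) \<Longrightarrow> P" for P
    by (auto simp: carr)
  show ?thesis
  proof (rule moduleI)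
    show "cring R" by (rule M.R.is_cring)
    show "abelian_group ?Q"
    proof (rule abelian_groupI)
      show "\<zero>\<^bsub>?Q\<^esub> \<in> carrier ?Q" by (simp add: zero closed)
      fix A assume "A \<in> carrier ?Q"
      then obtain a where a: "a \<in> carrier M" "A = H +>\<^bsub>M\<^esub> a" by (rule *)
      show "\<zero>\<^bsub>?Q\<^esub> \<oplus>\<^bsub>?Q\<^esub> A = A" using a by (simp add: zero)
      show "\<exists>B\<in>carrier ?Q. B \<oplus>\<^bsub>?Q\<^esub> A = \<zero>\<^bsub>?Q\<^esub>"
        by (rule bexI[of _ "H +>\<^bsub>M\<^esub> (\<ominus>\<^bsub>M\<^esub> a)"]) (simp_all add: a zero closed M.l_neg)
      fix B assume "B \<in> carrier ?Q"
      then obtain b where b: "b \<in> carrier M" "B = H +>\<^bsub>M\<^esub> b" by (rule *)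
      show "A \<oplus>\<^bsub>?Q\<^esub> B \<in> carrier ?Q" using a b by (simp add: closed)
      show "A \<oplus>\<^bsub>?Q\<^esub> B = B \<oplus>\<^bsub>?Q\<^esub> A" using a b by (simp add: M.a_comm)
      fix C assume "C \<in> carrier ?Q"
      then obtain c where "c \<in> carrier M" "C = H +>\<^bsub>M\<^esub> c" by (rule *)
      then show "A \<oplus>\<^bsub>?Q\<^esub> B \<oplus>\<^bsub>?Q\<^esub> C = A \<oplus>\<^bsub>?Q\<^esub> (B \<oplus>\<^bsub>?Q\<^esub> C)"
        using a b by (simp add: M.a_assoc)
    qed
    fix A assume "A \<in> carrier ?Q"
    then obtain a where a: "a \<in> carrier M" "A = H +>\<^bsub>M\<^esub> a" by (rule *)
    show "\<one>\<^bsub>R\<^esub> \<odot>\<^bsub>?Q\<^esub> A = A" using a by simp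
    fix r assume r: "r \<in> carrier R"
    show "r \<odot>\<^bsub>?Q\<^esub> A \<in> carrier ?Q" using a r by (simp add: closed)
    fix s assume "s \<in> carrier R"
    then show "(r \<oplus>\<^bsub>R\<^esub> s) \<odot>\<^bsub>?Q\<^esub> A = r \<odot>\<^bsub>?Q\<^esub> A \<oplus>\<^bsub>?Q\<^esub> s \<odot>\<^bsub>?Q\<^esub> A"
      and "(r \<otimes>\<^bsub>R\<^esub> s) \<odot>\<^bsub>?Q\<^esub> A = r \<odot>\<^bsub>?Q\<^esub> (s \<odot>\<^bsub>?Q\<^esub> A)"
      using a r by (simp_all add: M.smult_l_distr M.smult_assoc1)
  next
    fix r A B assume r: "r \<in> carrier R" and "A \<in> carrier ?Q" "B \<in> carrier ?Q"
    then obtain a b where "a \<in> carrier M" "A = H +>\<^bsub>M\<^esub> a" "b \<in> carrier M" "B = H +>\<^bsub>M\<^esub> b"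
      by (metis *)
    then show "r \<odot>\<^bsub>?Q\<^esub> (A \<oplus>\<^bsub>?Q\<^esub> B) = r \<odot>\<^bsub>?Q\<^esub> A \<oplus>\<^bsub>?Q\<^esub> r \<odot>\<^bsub>?Q\<^esub> B"
      using r by (simp add: M.smult_r_distr)
  qed
qed

lemma quotient_module_proj_linear:
  assumes "module R M" "submodule H R M"
  shows "(\<lambda>x. H +>\<^bsub>M\<^esub> x) \<in> linear_maps R M (quotient_module M H)"
  by (rule linear_mapsI)
     (simp_all add: carrier_quotient_module add_quotient_module[OF assms] smult_quotient_module[OF assms])

lemma submodule_generated_submodule:
  assumes "module R M" "S \<subseteq> carrier M"
  shows "submodule (generated_submodule R M S) R M"
proof -
  interpret module R M by fact
  have zero: "\<zero>\<^bsub>M\<^esub> \<in> H" if "submodule H R M" for H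
    using subgroup.one_closed[OF submodule.axioms(1)[OF that]] by simp
  show ?thesis
    unfolding generated_submodule_def
  proof (rule submoduleI, goal_cases)
    \<comment> \<open>Since \<open>S\<close> lies in the carrier, \<open>carrier M\<close> is one of
      the submodules intersected, and this bounds the intersection.\<close>
    case 1
    then show ?case using carrier_is_submodule assms(2) by blast
  qed (simp_all add: zero submoduleE submodule.smult_closed)
qed

lemma generated_submodule_superset: "S \<subseteq> generated_submodule R M S"
  by (auto simp: generated_submodule_def)

lemma generated_submodule_least: "submodule H R M \<Longrightarrow> S \<subseteq> H \<Longrightarrow> generated_submodule R M S \<subseteq> H"
  by (auto simp: generated_submodule_def)

lemma linear_map_kernel_submodule:
  assumes "module R M" "module R N" "h \<in> linear_maps R M N"
  shows "submodule {x \<in> carrier M. h x = \<zero>\<^bsub>N\<^esub>} R M"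
proof -
  interpret M: module R M by fact
  interpret N: module R N by fact
  interpret abelian_group_hom M N h by (rule linear_maps_hom[OF assms])
  show ?thesis
    by (rule M.submoduleI) (auto simp: linear_mapsD(3)[OF assms(3)])
qed

section \<open>Tensor products\<close>

text \<open>Linearity in one variable is demanded only while the other ranges over the carrier;
  outside the carriers the maps to be lifted have arbitrary values.\<close>

definition bilinear_maps ::
  "('r, 's) ring_scheme \<Rightarrow> ('r, 'a, 'b) module_scheme \<Rightarrow> ('r, 'c, 'd) module_scheme
    \<Rightarrow> ('r, 'p, 'q) module_scheme \<Rightarrow> ('a \<Rightarrow> 'c \<Rightarrow> 'p) set"
  where "bilinear_maps R M N P =
    {\<phi>. (\<forall>y\<in>carrier N. (\<lambda>x. \<phi> x y) \<in> linear_maps R M P) \<and>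
        (\<forall>x\<in>carrier M. \<phi> x \<in> linear_maps R N P)}"

lemma bilinear_mapsI:
  assumes "\<And>y. y \<in> carrier N \<Longrightarrow> (\<lambda>x. \<phi> x y) \<in> linear_maps R M P"
    and "\<And>x. x \<in> carrier M \<Longrightarrow> \<phi> x \<in> linear_maps R N P"
  shows "\<phi> \<in> bilinear_maps R M N P"
  using assms by (simp add: bilinear_maps_def)

lemma bilinear_mapsD:
  assumes "\<phi> \<in> bilinear_maps R M N P"
  shows "y \<in> carrier N \<Longrightarrow> (\<lambda>x. \<phi> x y) \<in> linear_maps R M P"
    and "x \<in> carrier M \<Longrightarrow> \<phi> x \<in> linear_maps R N P"
  using assms by (simp_all add: bilinear_maps_def)

lemma bilinear_maps_flip:
  "\<phi> \<in> bilinear_maps R M N P \<Longrightarrow> (\<lambda>y x. \<phi> x y) \<in> bilinear_maps R N M P"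
  by (simp add: bilinear_maps_def)

lemma bilinear_maps_comp:
  assumes "f \<in> linear_maps R M M'" "g \<in> linear_maps R N N'" "\<phi> \<in> bilinear_maps R M' N' P"
  shows "(\<lambda>x y. \<phi> (f x) (g y)) \<in> bilinear_maps R M N P"
proof (rule bilinear_mapsI)
  show "(\<lambda>x. \<phi> (f x) (g y)) \<in> linear_maps R M P" if "y \<in> carrier N" for y
    by (rule linear_maps_comp[OF assms(1) bilinear_mapsD(1)[OF assms(3) linear_mapsD(1)[OF assms(2) that]]])
  show "(\<lambda>y. \<phi> (f x) (g y)) \<in> linear_maps R N P" if "x \<in> carrier M" for x
    by (rule linear_maps_comp[OF assms(2) bilinear_mapsD(2)[OF assms(3) linear_mapsD(1)[OF assms(1) that]]])
qed

section \<open>The tensor product as a quotient by the bilinearity relations\<close>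

context
  fixes R :: "('r, 's) ring_scheme" and M :: "('r, 'a, 'b) module_scheme"
    and N :: "('r, 'c, 'd) module_scheme"
  assumes M: "module R M" and N: "module R N"
begin

interpretation M: module R M by (rule M)
interpretation N: module R N by (rule N)

private abbreviation (input) "F \<equiv> free_module R (carrier M \<times> carrier N)"
private abbreviation (input) "K \<equiv> tensor_kernel R M N"
private abbreviation (input) "gen \<equiv> basis_vector R"

interpretation F: module R F by (rule module_free_module) unfold_locales

private lemma gen_closed: "x \<in> carrier M \<Longrightarrow> y \<in> carrier N \<Longrightarrow> gen (x, y) \<in> carrier F"
  by (rule basis_vector_closed) (unfold_locales, simp)

private lemma relations_closed: "tensor_relations R M N \<subseteq> carrier F"
  unfolding tensor_relations_def Let_def
  by (auto intro!: F.minus_closed F.a_closed F.smult_closed gen_closed)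

private lemma K: "submodule K R F"
  unfolding tensor_kernel_def by (rule submodule_generated_submodule[OF F.module_axioms relations_closed])

lemma module_tensor_product: "module R (tensor_product R M N)"
  unfolding tensor_product_def by (rule module_quotient_module[OF F.module_axioms K])

private lemma proj_linear: "(\<lambda>f. K +>\<^bsub>F\<^esub> f) \<in> linear_maps R F (tensor_product R M N)"
  unfolding tensor_product_def by (rule quotient_module_proj_linear[OF F.module_axioms K])

private lemma coset_eqI:
  "a \<in> carrier F \<Longrightarrow> b \<in> carrier F \<Longrightarrow> a \<ominus>\<^bsub>F\<^esub> b \<in> tensor_relations R M N \<Longrightarrow> K +>\<^bsub>F\<^esub> a = K +>\<^bsub>F\<^esub> b"
  by (rule submodule_coset_eqI[OF F.module_axioms K])
     (auto simp only: tensor_kernel_def intro: subsetD[OF generated_submodule_superset])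

text \<open>Each of the four families of relations, read as an equality of cosets, is one of the
  four identities \<open>2\<close> to \<open>5\<close>.\<close>

lemma pure_tensor_bilinear:
  "pure_tensor R M N \<in> bilinear_maps R M N (tensor_product R M N)"
proof -
  note p = linear_mapsD[OF proj_linear]
  have 1: "pure_tensor R M N x y \<in> carrier (tensor_product R M N)"
    if "x \<in> carrier M" "y \<in> carrier N" for x y
    unfolding pure_tensor_def by (intro p gen_closed that)
  have 2: "pure_tensor R M N (x \<oplus>\<^bsub>M\<^esub> x') y
      = pure_tensor R M N x y \<oplus>\<^bsub>tensor_product R M N\<^esub> pure_tensor R M N x' y"
    if "x \<in> carrier M" "x' \<in> carrier M" "y \<in> carrier N" for x x' y
    unfolding pure_tensor_def p(2)[OF gen_closed[OF that(1,3)] gen_closed[OF that(2,3)], symmetric]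
    by (intro coset_eqI gen_closed F.a_closed M.a_closed that)
       (use that in \<open>unfold tensor_relations_def Let_def, blast\<close>)
  have 3: "pure_tensor R M N x (y \<oplus>\<^bsub>N\<^esub> y')
      = pure_tensor R M N x y \<oplus>\<^bsub>tensor_product R M N\<^esub> pure_tensor R M N x y'"
    if "x \<in> carrier M" "y \<in> carrier N" "y' \<in> carrier N" for x y y'
    unfolding pure_tensor_def p(2)[OF gen_closed[OF that(1,2)] gen_closed[OF that(1,3)], symmetric]
    by (intro coset_eqI gen_closed F.a_closed N.a_closed that)
       (use that in \<open>unfold tensor_relations_def Let_def, blast\<close>)
  have 4: "pure_tensor R M N (r \<odot>\<^bsub>M\<^esub> x) y = r \<odot>\<^bsub>tensor_product R M N\<^esub> pure_tensor R M N x y"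
    if "r \<in> carrier R" "x \<in> carrier M" "y \<in> carrier N" for r x y
    unfolding pure_tensor_def p(3)[OF gen_closed[OF that(2,3)] that(1), symmetric]
    by (intro coset_eqI gen_closed F.smult_closed M.smult_closed that)
       (use that in \<open>unfold tensor_relations_def Let_def, blast\<close>)
  have 5: "pure_tensor R M N x (r \<odot>\<^bsub>N\<^esub> y) = r \<odot>\<^bsub>tensor_product R M N\<^esub> pure_tensor R M N x y"
    if "r \<in> carrier R" "x \<in> carrier M" "y \<in> carrier N" for r x y
    unfolding pure_tensor_def p(3)[OF gen_closed[OF that(2,3)] that(1), symmetric]
    by (intro coset_eqI gen_closed F.smult_closed N.smult_closed that)
       (use that in \<open>unfold tensor_relations_def Let_def, blast\<close>)
  show ?thesis
    by (intro bilinear_mapsI linear_mapsI 1 2 3 4 5)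
qed

lemma pure_tensor_closed:
  "x \<in> carrier M \<Longrightarrow> y \<in> carrier N \<Longrightarrow> pure_tensor R M N x y \<in> carrier (tensor_product R M N)"
  using bilinear_mapsD(2)[OF pure_tensor_bilinear] linear_mapsD(1) by metis

text \<open>A coset of a linear combination of pairs is a sum of multiples of pure tensors, and a
  scalar is absorbed by the left factor. So sums and pure tensors are enough.\<close>

lemma tensor_product_induct:
  assumes "t \<in> carrier (tensor_product R M N)"
    and zero: "P \<zero>\<^bsub>tensor_product R M N\<^esub>"
    and add: "\<And>s t. s \<in> carrier (tensor_product R M N) \<Longrightarrow> t \<in> carrier (tensor_product R M N)
      \<Longrightarrow> P s \<Longrightarrow> P t \<Longrightarrow> P (s \<oplus>\<^bsub>tensor_product R M N\<^esub> t)"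
    and pure: "\<And>x y. x \<in> carrier M \<Longrightarrow> y \<in> carrier N \<Longrightarrow> P (pure_tensor R M N x y)"
  shows "P t"
proof -
  note p = linear_mapsD[OF proj_linear]
  obtain f where f: "f \<in> carrier F" "t = K +>\<^bsub>F\<^esub> f"
    using assms(1) by (auto simp: tensor_product_def carrier_quotient_module)
  have "cring R" by unfold_locales
  then have "P (K +>\<^bsub>F\<^esub> f)" using f(1)
  proof (induction rule: free_module_induct)
    case zero
    have "K +>\<^bsub>F\<^esub> \<zero>\<^bsub>F\<^esub> = \<zero>\<^bsub>tensor_product R M N\<^esub>"
      by (rule linear_maps_zero[OF F.module_axioms module_tensor_product proj_linear])
    then show ?case using assms(2) by (simp add: free_module_def)
  next
    case (add f g)
    then show ?case using p assms(3) by metis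
  next
    case (basis r z)
    then obtain x y where z: "z = (x, y)" "x \<in> carrier M" "y \<in> carrier N" by auto
    have "K +>\<^bsub>F\<^esub> (r \<odot>\<^bsub>F\<^esub> gen (x, y)) = r \<odot>\<^bsub>tensor_product R M N\<^esub> pure_tensor R M N x y"
      unfolding pure_tensor_def by (rule p(3)[OF gen_closed[OF z(2,3)] basis(1)])
    also have "\<dots> = pure_tensor R M N (r \<odot>\<^bsub>M\<^esub> x) y"
      using linear_mapsD(3)[OF bilinear_mapsD(1)[OF pure_tensor_bilinear z(3)] z(2) basis(1)] by simp
    finally show ?case using pure[of "r \<odot>\<^bsub>M\<^esub> x" y] z basis(1) by simp
  qed
  with f show ?thesis by simp
qed

section \<open>The universal property\<close>

context
  fixes P :: "('r, 'p, 'q) module_scheme" and \<phi> :: "'a \<Rightarrow> 'c \<Rightarrow> 'p"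
  assumes P: "module R P" and \<phi>: "\<phi> \<in> bilinear_maps R M N P"
begin

interpretation P: module R P by (rule P)

private abbreviation (input) "L \<equiv> linear_extension R P (case_prod \<phi>)"

private lemma phi_closed: "x \<in> carrier M \<Longrightarrow> y \<in> carrier N \<Longrightarrow> \<phi> x y \<in> carrier P"
  using bilinear_mapsD(2)[OF \<phi>] linear_mapsD(1) by metis

private lemma phi_funcset: "case_prod \<phi> \<in> carrier M \<times> carrier N \<rightarrow> carrier P"
  using phi_closed by auto

private lemma L_linear: "L \<in> linear_maps R F P"
  by (rule linear_extension_linear[OF P phi_funcset])

private lemma L_basis: "x \<in> carrier M \<Longrightarrow> y \<in> carrier N \<Longrightarrow> L (gen (x, y)) = \<phi> x y"
  using linear_extension_basis_vector[OF P phi_funcset] by simp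

text \<open>Bilinearity of \<phi> says that \<open>L\<close> kills every relation. The zeros of
  \<open>L\<close> form a submodule, and \<open>K\<close> is the least submodule containing the
  relations.\<close>

private lemma L_kernel: "K \<subseteq> {f \<in> carrier F. L f = \<zero>\<^bsub>P\<^esub>}"
  unfolding tensor_kernel_def
proof (rule generated_submodule_least[OF linear_map_kernel_submodule[OF F.module_axioms P L_linear]])
  note L = linear_maps_minus[OF F.module_axioms P L_linear] linear_mapsD[OF L_linear]
  note \<phi>1 = linear_mapsD[OF bilinear_mapsD(1)[OF \<phi>]]
  note \<phi>2 = linear_mapsD[OF bilinear_mapsD(2)[OF \<phi>]]
  have "L f = \<zero>\<^bsub>P\<^esub>" if "f \<in> tensor_relations R M N" for f
    using that unfolding tensor_relations_def Let_def
    by (auto simp: L L_basis gen_closed \<phi>1 \<phi>2 P.r_neg a_minus_def[of P] phi_closed)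
  then show "tensor_relations R M N \<subseteq> {f \<in> carrier F. L f = \<zero>\<^bsub>P\<^esub>}"
    using relations_closed by auto
qed

private lemma tensor_lift_coset:
  assumes "f \<in> carrier F"
  shows "tensor_lift R P \<phi> (K +>\<^bsub>F\<^esub> f) = L f"
proof -
  interpret K: abelian_subgroup K F by (rule submodule_abelian_subgroup[OF F.module_axioms K])
  have "L g = L f" if "g \<in> K +>\<^bsub>F\<^esub> f" for g
  proof -
    have "\<exists>h\<in>K. g = h \<oplus>\<^bsub>F\<^esub> f"
      using that unfolding a_r_coset_def' UN_iff singleton_iff .
    then obtain h where h: "h \<in> K" "g = h \<oplus>\<^bsub>F\<^esub> f" ..
    have hF: "h \<in> carrier F" and "L h = \<zero>\<^bsub>P\<^esub>"
      using subsetD[OF L_kernel h(1)] by simp_all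
    then show ?thesis
      unfolding h(2) linear_mapsD(2)[OF L_linear hF assms]
      using linear_mapsD(1)[OF L_linear assms] by simp
  qed
  then have "L ` (K +>\<^bsub>F\<^esub> f) = (\<lambda>_. L f) ` (K +>\<^bsub>F\<^esub> f)" by (rule image_cong[OF refl])
  \<comment> \<open>The coset contains \<open>f\<close>, so the image is not empty;
    \<open>the_elem\<close> has a specified value only on a singleton.\<close>
  also have "\<dots> = {L f}" by (rule image_constant[OF K.a_rcos_self[OF assms]])
  finally have "L ` (K +>\<^bsub>F\<^esub> f) = {L f}" .
  then show ?thesis by (simp add: tensor_lift_def)
qed

lemma tensor_lift_pure_tensor:
  "x \<in> carrier M \<Longrightarrow> y \<in> carrier N \<Longrightarrow> tensor_lift R P \<phi> (pure_tensor R M N x y) = \<phi> x y"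
  unfolding pure_tensor_def by (simp add: tensor_lift_coset gen_closed L_basis)

lemma tensor_lift_linear: "tensor_lift R P \<phi> \<in> linear_maps R (tensor_product R M N) P"
proof -
  note L = linear_mapsD[OF L_linear]
  have carr: "carrier (tensor_product R M N) = (\<lambda>f. K +>\<^bsub>F\<^esub> f) ` carrier F"
    by (simp add: tensor_product_def carrier_quotient_module)
  note p = linear_mapsD(2,3)[OF proj_linear, symmetric]
  show ?thesis
  proof (rule linear_mapsI)
    fix s assume "s \<in> carrier (tensor_product R M N)"
    then obtain f where f: "f \<in> carrier F" "s = K +>\<^bsub>F\<^esub> f" unfolding carr by blast
    show "tensor_lift R P \<phi> s \<in> carrier P" using f by (simp add: tensor_lift_coset L)
    show "tensor_lift R P \<phi> (r \<odot>\<^bsub>tensor_product R M N\<^esub> s) = r \<odot>\<^bsub>P\<^esub> tensor_lift R P \<phi> s"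
      if "r \<in> carrier R" for r
      using f that by (simp add: p tensor_lift_coset L)
    fix t assume "t \<in> carrier (tensor_product R M N)"
    then obtain g where "g \<in> carrier F" "t = K +>\<^bsub>F\<^esub> g" unfolding carr by blast
    then show "tensor_lift R P \<phi> (s \<oplus>\<^bsub>tensor_product R M N\<^esub> t) = tensor_lift R P \<phi> s \<oplus>\<^bsub>P\<^esub> tensor_lift R P \<phi> t"
      using f by (simp add: p tensor_lift_coset L)
  qed
qed

end

end

section \<open>Functoriality, and lifts depending on a parameter\<close>

lemma tensor_map_linear:
  assumes "module R M" "module R N" "module R P" "module R Q"
    and "f \<in> linear_maps R M P" "g \<in> linear_maps R N Q"
  shows "tensor_map R P Q f g \<in> linear_maps R (tensor_product R M N) (tensor_product R P Q)"
  unfolding tensor_map_def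
  by (intro tensor_lift_linear module_tensor_product bilinear_maps_comp[OF assms(5,6)]
        pure_tensor_bilinear assms)

lemma tensor_map_pure_tensor:
  assumes "module R M" "module R N" "module R P" "module R Q"
    and "f \<in> linear_maps R M P" "g \<in> linear_maps R N Q" "x \<in> carrier M" "y \<in> carrier N"
  shows "tensor_map R P Q f g (pure_tensor R M N x y) = pure_tensor R P Q (f x) (g y)"
  unfolding tensor_map_def
  by (intro tensor_lift_pure_tensor module_tensor_product bilinear_maps_comp[OF assms(5,6)]
        pure_tensor_bilinear assms)

text \<open>Linearity in the tensor holds for each parameter by the universal property. Linearity in
  the parameter \<open>z\<close> is proved by induction on the tensor: pure tensors are covered by
  assumption \<open>2\<close>, and linear maps are closed under zero and sums. This makes the outer
  lifts in \<open>tensor_assoc\<close> and \<open>tensor_swap12\<close> meaningful.\<close>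

lemma tensor_lift_bilinear:
  assumes M: "module R M" and N: "module R N" and P: "module R P"
    and 1: "\<And>z. z \<in> carrier Q \<Longrightarrow> (\<lambda>x y. \<phi> x y z) \<in> bilinear_maps R M N P"
    and 2: "\<And>x y. x \<in> carrier M \<Longrightarrow> y \<in> carrier N \<Longrightarrow> \<phi> x y \<in> linear_maps R Q P"
    and Q: "module R Q"
  shows "(\<lambda>t z. tensor_lift R P (\<lambda>x y. \<phi> x y z) t) \<in> bilinear_maps R (tensor_product R M N) Q P"
proof (rule bilinear_mapsI)
  note lift = tensor_lift_linear[OF M N P 1]
  note T = module_tensor_product[OF M N]
  show "tensor_lift R P (\<lambda>x y. \<phi> x y z) \<in> linear_maps R (tensor_product R M N) P"
    if "z \<in> carrier Q" for z
    by (rule lift[OF that])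
  \<comment> \<open>The lift is known to agree with the expected linear map only for
    \<open>z\<close> in the carrier, which is all that membership in \<open>linear_maps\<close>
    depends on.\<close>
  have cong: "f \<in> linear_maps R Q P"
    if "g \<in> linear_maps R Q P" "\<And>z. z \<in> carrier Q \<Longrightarrow> f z = g z" for f g
  proof -
    interpret Q: module R Q by (rule Q)
    show ?thesis
      using that(1) by (intro linear_mapsI) (simp_all add: that(2) linear_mapsD)
  qed
  show "(\<lambda>z. tensor_lift R P (\<lambda>x y. \<phi> x y z) t) \<in> linear_maps R Q P"
    if "t \<in> carrier (tensor_product R M N)" for t
  proof (rule tensor_product_induct[OF M N that])
    show "(\<lambda>z. tensor_lift R P (\<lambda>x y. \<phi> x y z) \<zero>\<^bsub>tensor_product R M N\<^esub>) \<in> linear_maps R Q P"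
      by (rule cong[OF linear_maps_const_zero[OF P]]) (rule linear_maps_zero[OF T P lift])
  next
    fix s t assume s: "s \<in> carrier (tensor_product R M N)" and t: "t \<in> carrier (tensor_product R M N)"
      and IH: "(\<lambda>z. tensor_lift R P (\<lambda>x y. \<phi> x y z) s) \<in> linear_maps R Q P"
        "(\<lambda>z. tensor_lift R P (\<lambda>x y. \<phi> x y z) t) \<in> linear_maps R Q P"
    show "(\<lambda>z. tensor_lift R P (\<lambda>x y. \<phi> x y z) (s \<oplus>\<^bsub>tensor_product R M N\<^esub> t)) \<in> linear_maps R Q P"
      by (rule cong[OF linear_maps_add[OF Q P IH]]) (rule linear_mapsD(2)[OF lift s t])
  next
    fix x y assume xy: "x \<in> carrier M" "y \<in> carrier N"
    show "(\<lambda>z. tensor_lift R P (\<lambda>x y. \<phi> x y z) (pure_tensor R M N x y)) \<in> linear_maps R Q P"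
      by (rule cong[OF 2[OF xy]]) (rule tensor_lift_pure_tensor[OF M N P 1 xy])
  qed
qed

section \<open>Reassociation and exchange in the threefold tensor product\<close>

context
  fixes R :: "('r, 's) ring_scheme" and A :: "('r, 'a, 'b) module_scheme"
  assumes A: "module R A"
begin

lemmas module_tensor_square = module_tensor_product[OF A A]
lemmas module_tensor_cube = module_tensor_product[OF A module_tensor_square]

text \<open>With the bracketing of the cube, the first variable enters through the outer tensor
  alone, the other two through both tensors.\<close>

lemma pure_tensor3_linear:
  "b \<in> carrier A \<Longrightarrow> c \<in> carrier A \<Longrightarrow> (\<lambda>a. pure_tensor3 R A a b c) \<in> linear_maps R A (tensor_cube R A)"
  "a \<in> carrier A \<Longrightarrow> c \<in> carrier A \<Longrightarrow> (\<lambda>b. pure_tensor3 R A a b c) \<in> linear_maps R A (tensor_cube R A)"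
  "a \<in> carrier A \<Longrightarrow> b \<in> carrier A \<Longrightarrow> pure_tensor3 R A a b \<in> linear_maps R A (tensor_cube R A)"
proof -
  note p2 = pure_tensor_bilinear[OF A A]
  note p3 = pure_tensor_bilinear[OF A module_tensor_square]
  show "(\<lambda>a. pure_tensor3 R A a b c) \<in> linear_maps R A (tensor_cube R A)"
    if "b \<in> carrier A" "c \<in> carrier A"
    unfolding pure_tensor3_def by (rule bilinear_mapsD(1)[OF p3 pure_tensor_closed[OF A A that]])
  show "(\<lambda>b. pure_tensor3 R A a b c) \<in> linear_maps R A (tensor_cube R A)"
    if "a \<in> carrier A" "c \<in> carrier A"
    unfolding pure_tensor3_def
    by (rule linear_maps_comp[OF bilinear_mapsD(1)[OF p2 that(2)] bilinear_mapsD(2)[OF p3 that(1)]])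
  show "pure_tensor3 R A a b \<in> linear_maps R A (tensor_cube R A)"
    if "a \<in> carrier A" "b \<in> carrier A"
    unfolding pure_tensor3_def
    by (rule linear_maps_comp[OF bilinear_mapsD(2)[OF p2 that(2)] bilinear_mapsD(2)[OF p3 that(1)]])
qed

lemma pure_tensor3_closed:
  "a \<in> carrier A \<Longrightarrow> b \<in> carrier A \<Longrightarrow> c \<in> carrier A \<Longrightarrow> pure_tensor3 R A a b c \<in> carrier (tensor_cube R A)"
  by (rule linear_mapsD(1)[OF pure_tensor3_linear(3)])

private lemma pure_tensor3_assoc_bilinear:
  "c \<in> carrier A \<Longrightarrow> (\<lambda>a b. pure_tensor3 R A a b c) \<in> bilinear_maps R A A (tensor_cube R A)"
  by (intro bilinear_mapsI pure_tensor3_linear)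

private lemma pure_tensor3_swap_bilinear:
  "a \<in> carrier A \<Longrightarrow> (\<lambda>b c. pure_tensor3 R A b a c) \<in> bilinear_maps R A A (tensor_cube R A)"
  by (intro bilinear_mapsI pure_tensor3_linear)

private lemma assoc_bilinear:
  "(\<lambda>u c. tensor_lift R (tensor_cube R A) (\<lambda>a b. pure_tensor3 R A a b c) u)
    \<in> bilinear_maps R (tensor_square R A) A (tensor_cube R A)"
  by (intro tensor_lift_bilinear A module_tensor_cube pure_tensor3_assoc_bilinear pure_tensor3_linear)

text \<open>Here the tensor is the second argument, whereas \<open>tensor_lift_bilinear\<close> has
  it first; hence the flip.\<close>

private lemma swap_bilinear:
  "(\<lambda>a u. tensor_lift R (tensor_cube R A) (\<lambda>b c. pure_tensor3 R A b a c) u)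
    \<in> bilinear_maps R A (tensor_square R A) (tensor_cube R A)"
  by (rule bilinear_maps_flip)
     (intro tensor_lift_bilinear A module_tensor_cube pure_tensor3_swap_bilinear pure_tensor3_linear)

lemma tensor_assoc_linear:
  "tensor_assoc R A \<in> linear_maps R (tensor_product R (tensor_square R A) A) (tensor_cube R A)"
  unfolding tensor_assoc_def
  by (rule tensor_lift_linear[OF module_tensor_square A module_tensor_cube assoc_bilinear])

lemma tensor_assoc_pure_tensor:
  assumes "a \<in> carrier A" "b \<in> carrier A" "c \<in> carrier A"
  shows "tensor_assoc R A (pure_tensor R (tensor_square R A) A (pure_tensor R A A a b) c)
    = pure_tensor3 R A a b c"
  unfolding tensor_assoc_def
    tensor_lift_pure_tensor[OF module_tensor_square A module_tensor_cube assoc_bilinear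
      pure_tensor_closed[OF A A assms(1,2)] assms(3)]
  by (rule tensor_lift_pure_tensor[OF A A module_tensor_cube pure_tensor3_assoc_bilinear[OF assms(3)] assms(1,2)])

lemma tensor_swap12_linear:
  "tensor_swap12 R A \<in> linear_maps R (tensor_cube R A) (tensor_cube R A)"
  unfolding tensor_swap12_def
  by (rule tensor_lift_linear[OF A module_tensor_square module_tensor_cube swap_bilinear])

lemma tensor_swap12_pure_tensor3:
  assumes "a \<in> carrier A" "b \<in> carrier A" "c \<in> carrier A"
  shows "tensor_swap12 R A (pure_tensor3 R A a b c) = pure_tensor3 R A b a c"
  unfolding tensor_swap12_def pure_tensor3_def[of R A a]
    tensor_lift_pure_tensor[OF A module_tensor_square module_tensor_cube swap_bilinear
      assms(1) pure_tensor_closed[OF A A assms(2,3)]]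
  by (rule tensor_lift_pure_tensor[OF A A module_tensor_cube pure_tensor3_swap_bilinear[OF assms(1)] assms(2,3)])

lemma coassociator_linear:
  assumes "\<rho> \<in> linear_maps R A (tensor_square R A)"
  shows "coassociator R A \<rho> \<in> linear_maps R A (tensor_cube R A)"
  unfolding coassociator_def
  by (intro linear_maps_diff A module_tensor_cube
        linear_maps_comp[OF assms tensor_map_linear[OF A A A module_tensor_square linear_maps_id assms]]
        linear_maps_comp[OF linear_maps_comp[OF assms
          tensor_map_linear[OF A A module_tensor_square A assms linear_maps_id]] tensor_assoc_linear])

end

section \<open>Splittings of words\<close>

definition splittings :: "'a list \<Rightarrow> ('a list \<times> 'a \<times> 'a list \<times> 'a \<times> 'a list) set"
  where "splittings w = {(u, a, v, b, z). w = u @ a # v @ b # z}"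

text \<open>The two numbers are the positions of the marked letters \<open>a\<close> and
  \<open>b\<close>, counted from 1. They determine the lengths of \<open>u\<close> and
  \<open>v\<close>, hence the whole splitting of the fixed word.\<close>

lemma splittings_lengths_inj: "inj_on (\<lambda>(u, a, v, b, z). (length u + 1, length u + length v + 2)) (splittings w)"
  by (auto simp: inj_on_def splittings_def)

lemma splittings_lengths_image:
  "(\<lambda>(u, a, v, b, z). (length u + 1, length u + length v + 2)) ` splittings w
    = {(i, j). 1 \<le> i \<and> i < j \<and> j \<le> length w}" (is "?h ` _ = ?I")
proof (intro equalityI subsetI)
  fix p assume "p \<in> ?I"
  then obtain i j where p: "p = (i, j)" "1 \<le> i" "i < j" "j \<le> length w" by auto
  \<comment> \<open>\<open>drop i w\<close> begins just after the letter at position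
    \<open>i\<close>, and \<open>j - 1 - i\<close> letters lie strictly between the two positions;
    \<open>i < j\<close> prevents truncated subtraction.\<close>
  define s where "s = (take (i - 1) w, w ! (i - 1), take (j - 1 - i) (drop i w), w ! (j - 1), drop j w)"
  have "w = take (i - 1) w @ w ! (i - 1) # drop i w"
    using p id_take_nth_drop[of "i - 1" w] by simp
  moreover have "drop i w = take (j - 1 - i) (drop i w) @ w ! (j - 1) # drop j w"
    using p id_take_nth_drop[of "j - 1 - i" "drop i w"] by simp
  ultimately have "s \<in> splittings w" by (simp add: s_def splittings_def)
  moreover have "?h s = p" using p by (simp add: s_def)
  ultimately show "p \<in> ?h ` splittings w" by force
qed (auto simp: splittings_def)

lemma finite_splittings: "finite (splittings w)"
proof (rule finite_imageD[OF _ splittings_lengths_inj])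
  have "{(i, j). 1 \<le> i \<and> i < j \<and> j \<le> length w} \<subseteq> {..length w} \<times> {..length w}" by auto
  then show "finite ((\<lambda>(u, a, v, b, z). (length u + 1, length u + length v + 2)) ` splittings w)"
    unfolding splittings_lengths_image by (rule finite_subset) simp
qed

text \<open>The right end \<open>j\<close> is excluded, so it may be as large as
  \<open>length w + 1\<close>; the left end counts from 1 and \<open>drop\<close> from 0.\<close>

lemma subword_eq_take_drop:
  assumes "1 \<le> i" "j \<le> length w + 1"
  shows "subword w i j = take (j - i) (drop (i - 1) w)"
proof (rule nth_equalityI)
  show "length (subword w i j) = length (take (j - i) (drop (i - 1) w))"
    using assms by (simp add: subword_def)
  fix k assume "k < length (subword w i j)"
  then show "subword w i j ! k = take (j - i) (drop (i - 1) w) ! k"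
    using assms by (simp add: subword_def letter_def)
qed

lemma splittings_subword:
  assumes w: "w = u @ a # v @ b # z"
  shows "letter w (length u + 1) = a" "letter w (length u + length v + 2) = b"
    and "subword w (length u + 1 + 1) (length u + length v + 2) = v"
    and "subword w 1 (length u + 1) = u"
    and "subword w (length u + length v + 2 + 1) (length w + 1) = z"
proof -
  \<comment> \<open>The index of \<open>b\<close> counted from 0, grouped as the length of
    \<open>u\<close> plus an offset to suit \<open>nth_append_length_plus\<close>.\<close>
  have "w ! (length u + (1 + length v)) = b"
    unfolding w nth_append_length_plus by simp
  then show "letter w (length u + length v + 2) = b" by (simp add: letter_def)
qed (simp_all add: subword_eq_take_drop letter_def w)

section \<open>Configurations of two cuts\<close>

definition disjoint_splittings where
  "disjoint_splittings w =
    {(x, c, y, d, s, a, v, b, z). w = x @ c # y @ d # s @ a # v @ b # z}"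

definition nested_splittings where
  "nested_splittings w =
    {(x, c, s, a, v, b, t, d, z). w = x @ c # s @ a # v @ b # t @ d # z}"

text \<open>
  A two-step splitting is a pair consisting of a splitting \<open>(u, a, v, b, z)\<close> of \<open>w\<close> and a splitting of
  \<open>u @ z\<close> (for \<open>(id \<otimes> \<rho>) \<rho>\<close>) or of \<open>v\<close> (for \<open>(\<rho> \<otimes> id) \<rho>\<close>, only in \<open>outer_first\<close>). The maps below
  are named after the factor of \<open>w\<close> that is cut out in the first step.
\<close>

definition right_first where
  "right_first = (\<lambda>(x, c, y, d, s, a, v, b, z).
    ((x @ c # y @ d # s, a, v, b, z), (x, c, y, d, s @ z)))"

definition left_first where
  "left_first = (\<lambda>(x, c, y, d, s, a, v, b, z).
    ((x, c, y, d, s @ a # v @ b # z), (x @ s, a, v, b, z)))"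

definition inner_first where
  "inner_first = (\<lambda>(x, c, s, a, v, b, t, d, z).
    ((x @ c # s, a, v, b, t @ d # z), (x, c, s @ t, d, z)))"

definition outer_first where
  "outer_first = (\<lambda>(x, c, s, a, v, b, t, d, z).
    ((x, c, s @ a # v @ b # t, d, z), (s, a, v, b, t)))"

text \<open>Each component of the tuple occurs in the image alone, or in a concatenation whose other
  parts are known, so cancellation recovers it. Injectivity allows sums over the images to be
  reindexed.\<close>

lemma right_first_inj: "inj right_first" and left_first_inj: "inj left_first"
  and inner_first_inj: "inj inner_first" and outer_first_inj: "inj outer_first"
  by (auto simp: inj_def right_first_def left_first_def inner_first_def outer_first_def)

text \<open>A splitting of the factor \<open>v\<close> just refines the splitting of
  \<open>w\<close>, with no seam to cross; so there is a single kind of configuration.\<close>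

lemma outer_first_image:
  "outer_first ` nested_splittings w = Sigma (splittings w) (\<lambda>(u, a, v, b, z). splittings v)"
  by (force simp: outer_first_def nested_splittings_def splittings_def image_def)

lemma two_step_images:
  "Sigma (splittings w) (\<lambda>(u, a, v, b, z). splittings (u @ z)) =
    right_first ` disjoint_splittings w \<union> left_first ` disjoint_splittings w \<union> inner_first ` nested_splittings w"
    (is "?S = ?A \<union> ?B \<union> ?C")
proof (intro equalityI subsetI)
  fix p assume "p \<in> ?S"
  then obtain u a v b z x c y d z' where p: "p = ((u, a, v, b, z), (x, c, y, d, z'))"
    and w: "w = u @ a # v @ b # z" and uz: "u @ z = x @ c # y @ d # z'"
    by (auto simp: splittings_def)
  \<comment> \<open>The seam between \<open>u\<close> and \<open>z\<close> falls inside
    \<open>x\<close>, inside \<open>z'\<close> or inside \<open>y\<close>, ends included, as it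
    cannot cut a letter. The words \<open>s\<close> and \<open>t\<close> are the pieces next to the
    seam.\<close>
  from uz consider (1) s where "x = u @ s" "z = s @ c # y @ d # z'"
    | (2) s where "u = x @ c # y @ d # s" "z' = s @ z"
    | (3) s t where "u = x @ c # s" "y = s @ t" "z = t @ d # z'"
    by (auto simp: append_eq_append_conv2 append_eq_Cons_conv)
  then show "p \<in> ?A \<union> ?B \<union> ?C"
  proof cases
    case 1
    then have "p = left_first (u, a, v, b, s, c, y, d, z')" "(u, a, v, b, s, c, y, d, z') \<in> disjoint_splittings w"
      by (simp_all add: p w left_first_def disjoint_splittings_def)
    then show ?thesis by blast
  next
    case 2
    then have "p = right_first (x, c, y, d, s, a, v, b, z)" "(x, c, y, d, s, a, v, b, z) \<in> disjoint_splittings w"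
      by (simp_all add: p w right_first_def disjoint_splittings_def)
    then show ?thesis by blast
  next
    case 3
    then have "p = inner_first (x, c, s, a, v, b, t, d, z')" "(x, c, s, a, v, b, t, d, z') \<in> nested_splittings w"
      by (simp_all add: p w inner_first_def nested_splittings_def)
    then show ?thesis by blast
  qed
qed (auto simp: splittings_def disjoint_splittings_def nested_splittings_def
    right_first_def left_first_def inner_first_def)

text \<open>For a second splitting \<open>(x, c, y, d, z')\<close> of \<open>u @ z\<close>, the
  length of \<open>u\<close> is at most \<open>length x\<close> on the left family, between
  \<open>length x + 1\<close> and \<open>length x + length y + 1\<close> on the inner one, and
  larger on the right one.\<close>

lemma two_step_images_disjoint:
  "(right_first ` disjoint_splittings w \<union> left_first ` disjoint_splittings w) \<inter> inner_first ` nested_splittings w = {}"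
  "right_first ` disjoint_splittings w \<inter> left_first ` disjoint_splittings w = {}"
  by (auto simp: right_first_def left_first_def inner_first_def)

lemma finite_two_step:
  "finite (Sigma (splittings w) (\<lambda>(u, a, v, b, z). splittings (u @ z)))"
  by (intro finite_SigmaI finite_splittings) (auto simp: finite_splittings)

text \<open>Inherited through an injection into the two-step splittings, which are finite as a
  dependent sum.\<close>

lemma finite_disjoint_splittings: "finite (disjoint_splittings w)"
  using finite_two_step[of w] finite_imageD[OF _ inj_on_subset[OF right_first_inj subset_UNIV]]
  unfolding two_step_images by blast

lemma finite_nested_splittings: "finite (nested_splittings w)"
  using finite_two_step[of w] finite_imageD[OF _ inj_on_subset[OF inner_first_inj subset_UNIV]]
  unfolding two_step_images by blast

section \<open>The comultiplication on words\<close>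

text \<open>Turns a comultiplication applied twice into one sum over two-step splittings, where the
  bijections between configurations can act.\<close>

lemma (in abelian_monoid) finsum_Sigma:
  assumes "finite S" "\<And>x. x \<in> S \<Longrightarrow> finite (T x)"
    and "\<And>x y. x \<in> S \<Longrightarrow> y \<in> T x \<Longrightarrow> f x y \<in> carrier G"
  shows "(\<Oplus>x\<in>S. \<Oplus>y\<in>T x. f x y) = (\<Oplus>p\<in>Sigma S T. case_prod f p)"
  using assms
proof (induction S rule: finite_induct)
  case (insert a S)
  have Sig: "Sigma (insert a S) T = Pair a ` T a \<union> Sigma S T" by auto
  have fa: "f a \<in> T a \<rightarrow> carrier G" using insert.prems by simp
  have fS: "(\<lambda>x. \<Oplus>y\<in>T x. f x y) \<in> S \<rightarrow> carrier G"
    using insert.prems by (intro funcsetI finsum_closed) simp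
  have "(\<Oplus>p\<in>Sigma (insert a S) T. case_prod f p)
      = (\<Oplus>p\<in>Pair a ` T a. case_prod f p) \<oplus> (\<Oplus>p\<in>Sigma S T. case_prod f p)"
    unfolding Sig using insert by (intro finsum_Un_disjoint) auto
  also have "(\<Oplus>p\<in>Pair a ` T a. case_prod f p) = (\<Oplus>y\<in>T a. f a y)"
    using fa by (subst finsum_reindex) (auto simp: inj_on_def)
  also have "(\<Oplus>p\<in>Sigma S T. case_prod f p) = (\<Oplus>x\<in>S. \<Oplus>y\<in>T x. f x y)"
    using insert by simp
  finally show ?case
    using insert.hyps fa fS by (simp add: finsum_closed)
qed simp

context
  fixes R :: "('r, 's) ring_scheme" and \<A> :: "'a set" and \<mu> :: "'a \<times> 'a \<Rightarrow> 'r"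
  assumes R: "cring R" and \<mu>: "\<mu> \<in> \<A> \<times> \<A> \<rightarrow> carrier R"
begin

private abbreviation (input) "W \<equiv> word_module R \<A>"
private abbreviation (input) "T \<equiv> tensor_square R W"
private abbreviation (input) "C \<equiv> tensor_cube R W"
private abbreviation (input) "e \<equiv> basis_vector R"
private abbreviation (input) "\<rho> \<equiv> word_comult R \<A> \<mu>"

private lemma W: "module R W"
  unfolding word_module_def by (rule module_free_module[OF R])

interpretation W: module R W by (rule W)
interpretation T: module R T by (rule module_tensor_square[OF W])
interpretation C: module R C by (rule module_tensor_cube[OF W])

private lemma e_closed: "w \<in> lists \<A> \<Longrightarrow> e w \<in> carrier W"
  unfolding word_module_def by (rule basis_vector_closed[OF R])

private lemma mu_closed: "a \<in> \<A> \<Longrightarrow> b \<in> \<A> \<Longrightarrow> \<mu> (a, b) \<in> carrier R"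
  using \<mu> by auto

private lemma comult_term_closed:
  assumes "w \<in> lists \<A>"
  shows "(\<lambda>(u, a, v, b, z). \<mu> (a, b) \<odot>\<^bsub>T\<^esub> pure_tensor R W W (e v) (e (u @ z)))
    \<in> splittings w \<rightarrow> carrier T"
proof (clarsimp simp only: splittings_def mem_Collect_eq funcset_mem Pi_iff)
  fix u a v b z assume "w = u @ a # v @ b # z"
  with assms show "\<mu> (a, b) \<odot>\<^bsub>T\<^esub> pure_tensor R W W (e v) (e (u @ z)) \<in> carrier T"
    by (intro T.smult_closed mu_closed pure_tensor_closed[OF W W] e_closed) simp_all
qed

text \<open>Reindexing along the bijection between splittings and pairs of positions; from here on
  positions no longer occur.\<close>

private lemma word_comult_on_basis_eq:
  assumes "w \<in> lists \<A>"
  shows "word_comult_on_basis R \<A> \<mu> w =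
    finsum T (\<lambda>(u, a, v, b, z). \<mu> (a, b) \<odot>\<^bsub>T\<^esub> pure_tensor R W W (e v) (e (u @ z))) (splittings w)"
proof -
  let ?h = "\<lambda>(u, a, v, b, z). (length u + 1, length u + length v + 2)"
  let ?g = "\<lambda>(i, j). \<mu> (letter w i, letter w j) \<odot>\<^bsub>T\<^esub>
    pure_tensor R W W (e (subword w (i + 1) j)) (e (subword w 1 i @ subword w (j + 1) (length w + 1)))"
  let ?f = "\<lambda>(u, a, v, b, z). \<mu> (a, b) \<odot>\<^bsub>T\<^esub> pure_tensor R W W (e v) (e (u @ z))"
  have gf: "?g (?h p) = ?f p" if "p \<in> splittings w" for p
  proof -
    obtain u a v b z where p: "p = (u, a, v, b, z)" by (cases p)
    then have "w = u @ a # v @ b # z" using that by (simp add: splittings_def)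
    note splittings_subword[OF this]
    then show ?thesis unfolding p by (simp only: prod.case)
  qed
  have "word_comult_on_basis R \<A> \<mu> w = finsum T ?g (?h ` splittings w)"
    unfolding word_comult_on_basis_def Let_def splittings_lengths_image ..
  also have "\<dots> = (\<Oplus>\<^bsub>T\<^esub>p\<in>splittings w. ?g (?h p))"
    by (rule T.finsum_reindex[OF _ splittings_lengths_inj])
       (use gf comult_term_closed[OF assms] in \<open>simp only: Pi_iff ball_simps, simp\<close>)
  also have "\<dots> = finsum T ?f (splittings w)"
    by (rule T.finsum_cong'[OF refl comult_term_closed[OF assms] gf])
  finally show ?thesis .
qed

lemma word_comult_linear: "\<rho> \<in> linear_maps R W T"
  and word_comult_basis_vector: "w \<in> lists \<A> \<Longrightarrow> \<rho> (e w) =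
    finsum T (\<lambda>(u, a, v, b, z). \<mu> (a, b) \<odot>\<^bsub>T\<^esub> pure_tensor R W W (e v) (e (u @ z))) (splittings w)"
proof -
  have *: "word_comult_on_basis R \<A> \<mu> \<in> lists \<A> \<rightarrow> carrier T"
    by (intro funcsetI) (simp only: word_comult_on_basis_eq T.finsum_closed comult_term_closed)
  show "\<rho> \<in> linear_maps R W T"
    using linear_extension_linear[OF T.module_axioms *]
    unfolding word_comult_def word_module_def .
  show "\<rho> (e w) =
    finsum T (\<lambda>(u, a, v, b, z). \<mu> (a, b) \<odot>\<^bsub>T\<^esub> pure_tensor R W W (e v) (e (u @ z))) (splittings w)"
    if "w \<in> lists \<A>"
    unfolding word_comult_def linear_extension_basis_vector[OF T.module_axioms * that]
    by (rule word_comult_on_basis_eq[OF that])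
qed

text \<open>Stated for arbitrary linear \<open>h\<close> because it serves twice: for the first cut
  with \<open>h\<close> the map applied to \<rho>(w), and for the second cut with \<open>h\<close>
  tensoring by the word that the second cut does not touch.\<close>

private lemma linear_comult:
  assumes "h \<in> linear_maps R T C" "w \<in> lists \<A>"
  shows "h (\<rho> (e w)) =
    finsum C (\<lambda>(u, a, v, b, z). \<mu> (a, b) \<odot>\<^bsub>C\<^esub> h (pure_tensor R W W (e v) (e (u @ z)))) (splittings w)"
proof -
  note h = linear_mapsD[OF assms(1)]
  have "h (\<rho> (e w)) = (\<Oplus>\<^bsub>C\<^esub>p\<in>splittings w.
      h (case p of (u, a, v, b, z) \<Rightarrow> \<mu> (a, b) \<odot>\<^bsub>T\<^esub> pure_tensor R W W (e v) (e (u @ z))))"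
    unfolding word_comult_basis_vector[OF assms(2)]
    by (rule linear_maps_finsum[OF T.module_axioms C.module_axioms assms(1) comult_term_closed[OF assms(2)]])
  also have "\<dots> = finsum C (\<lambda>(u, a, v, b, z). \<mu> (a, b) \<odot>\<^bsub>C\<^esub> h (pure_tensor R W W (e v) (e (u @ z)))) (splittings w)"
  proof (rule C.finsum_cong'[OF refl])
    have *: "pure_tensor R W W (e v) (e (u @ z)) \<in> carrier T" "\<mu> (a, b) \<in> carrier R"
      if "w = u @ a # v @ b # z" for u a v b z
      using assms(2) that by (auto intro!: mu_closed pure_tensor_closed[OF W W] e_closed)
    show "(\<lambda>(u, a, v, b, z). \<mu> (a, b) \<odot>\<^bsub>C\<^esub> h (pure_tensor R W W (e v) (e (u @ z))))
        \<in> splittings w \<rightarrow> carrier C"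
      by (auto simp: splittings_def intro!: C.smult_closed h(1) *)
    show "h (case p of (u, a, v, b, z) \<Rightarrow> \<mu> (a, b) \<odot>\<^bsub>T\<^esub> pure_tensor R W W (e v) (e (u @ z)))
        = (case p of (u, a, v, b, z) \<Rightarrow> \<mu> (a, b) \<odot>\<^bsub>C\<^esub> h (pure_tensor R W W (e v) (e (u @ z))))"
      if "p \<in> splittings w" for p
      using that by (cases p) (simp add: splittings_def h(3)[OF *])
  qed
  finally show ?thesis .
qed

section \<open>Sums over two successive cuts\<close>

private definition "right_term = (\<lambda>(u, a, v, b, z) (x, c, y, d, z').
  \<mu> (c, d) \<odot>\<^bsub>C\<^esub> (\<mu> (a, b) \<odot>\<^bsub>C\<^esub> pure_tensor3 R W (e v) (e y) (e (x @ z'))))"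

private definition "left_term = (\<lambda>(u, a, v, b, z) (x, c, y, d, z').
  \<mu> (c, d) \<odot>\<^bsub>C\<^esub> (\<mu> (a, b) \<odot>\<^bsub>C\<^esub> pure_tensor3 R W (e y) (e (x @ z')) (e (u @ z))))"

private lemma two_step_closed:
  "a \<in> \<A> \<Longrightarrow> b \<in> \<A> \<Longrightarrow> c \<in> \<A> \<Longrightarrow> d \<in> \<A> \<Longrightarrow> u \<in> lists \<A> \<Longrightarrow> v \<in> lists \<A> \<Longrightarrow> w \<in> lists \<A> \<Longrightarrow>
    \<mu> (a, b) \<odot>\<^bsub>C\<^esub> (\<mu> (c, d) \<odot>\<^bsub>C\<^esub> pure_tensor3 R W (e u) (e v) (e w)) \<in> carrier C"
  by (intro C.smult_closed mu_closed pure_tensor3_closed[OF W] e_closed)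

text \<open>Terms to be compared arise from the same two cuts in opposite order, so their scalars
  come nested in opposite order.\<close>

private lemma smult_commute:
  "a \<in> \<A> \<Longrightarrow> b \<in> \<A> \<Longrightarrow> c \<in> \<A> \<Longrightarrow> d \<in> \<A> \<Longrightarrow> t \<in> carrier C \<Longrightarrow>
    \<mu> (a, b) \<odot>\<^bsub>C\<^esub> (\<mu> (c, d) \<odot>\<^bsub>C\<^esub> t) = \<mu> (c, d) \<odot>\<^bsub>C\<^esub> (\<mu> (a, b) \<odot>\<^bsub>C\<^esub> t)"
  by (simp only: C.smult_assoc1[symmetric] mu_closed W.R.m_comm)

private lemma right_term_closed:
  assumes "w \<in> lists \<A>"
  shows "case_prod right_term \<in> Sigma (splittings w) (\<lambda>(u, a, v, b, z). splittings (u @ z)) \<rightarrow> carrier C"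
proof (intro funcsetI, elim SigmaE, clarsimp simp only: prod.case)
  fix u a v b z x c y d z'
  assume "(u, a, v, b, z) \<in> splittings w" "(x, c, y, d, z') \<in> splittings (u @ z)"
  then have "w = u @ a # v @ b # z" and uz: "u @ z = x @ c # y @ d # z'"
    by (simp_all add: splittings_def)
  with assms have "x @ c # y @ d # z' \<in> lists \<A>" "v \<in> lists \<A>" "a \<in> \<A>" "b \<in> \<A>"
    unfolding uz[symmetric] by simp_all
  then show "right_term (u, a, v, b, z) (x, c, y, d, z') \<in> carrier C"
    unfolding right_term_def prod.case by (intro two_step_closed) simp_all
qed

private lemma left_term_closed:
  assumes "w \<in> lists \<A>"
  shows "case_prod left_term \<in> Sigma (splittings w) (\<lambda>(u, a, v, b, z). splittings v) \<rightarrow> carrier C"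
proof (intro funcsetI, elim SigmaE, clarsimp simp only: prod.case)
  fix u a v b z x c y d z'
  assume "(u, a, v, b, z) \<in> splittings w" "(x, c, y, d, z') \<in> splittings v"
  then have "w = u @ a # v @ b # z" and v: "v = x @ c # y @ d # z'"
    by (simp_all add: splittings_def)
  then show "left_term (u, a, v, b, z) (x, c, y, d, z') \<in> carrier C"
    unfolding left_term_def prod.case using assms by (intro two_step_closed) simp_all
qed

private lemma comult_right:
  assumes w: "w \<in> lists \<A>"
  shows "tensor_map R W T id \<rho> (\<rho> (e w)) =
    (\<Oplus>\<^bsub>C\<^esub>p\<in>Sigma (splittings w) (\<lambda>(u, a, v, b, z). splittings (u @ z)). case_prod right_term p)"
proof -
  note lin = tensor_map_linear[OF W W W T.module_axioms linear_maps_id word_comult_linear]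
  note pure = tensor_map_pure_tensor[OF W W W T.module_axioms linear_maps_id word_comult_linear]
  have "tensor_map R W T id \<rho> (\<rho> (e w)) =
    (\<Oplus>\<^bsub>C\<^esub>p\<in>splittings w. \<Oplus>\<^bsub>C\<^esub>q\<in>(case p of (u, a, v, b, z) \<Rightarrow> splittings (u @ z)). right_term p q)"
    unfolding linear_comult[OF lin w]
  proof (rule C.finsum_cong'[OF refl])
    show "(\<lambda>p. \<Oplus>\<^bsub>C\<^esub>q\<in>(case p of (u, a, v, b, z) \<Rightarrow> splittings (u @ z)). right_term p q)
        \<in> splittings w \<rightarrow> carrier C"
      by (intro funcsetI C.finsum_closed) (use right_term_closed[OF w] in \<open>force simp: Pi_iff\<close>)
    fix p assume "p \<in> splittings w"
    then obtain u a v b z where p: "p = (u, a, v, b, z)" and "w = u @ a # v @ b # z"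
      by (cases p) (simp add: splittings_def)
    with w have mem: "u @ z \<in> lists \<A>" "v \<in> lists \<A>" "a \<in> \<A>" "b \<in> \<A>" by simp_all
    \<comment> \<open>The first scalar is made part of the linear map, so that
      \<open>linear_comult\<close> yields the summands of \<open>right_term\<close> directly, with
      the second scalar outermost.\<close>
    have lin2: "(\<lambda>t. \<mu> (a, b) \<odot>\<^bsub>C\<^esub> pure_tensor R W T (e v) t) \<in> linear_maps R T C"
      by (intro linear_maps_smult C.module_axioms mu_closed mem e_closed
          bilinear_mapsD(2)[OF pure_tensor_bilinear[OF W T.module_axioms]])
    show "(case p of (u, a, v, b, z) \<Rightarrow> \<mu> (a, b) \<odot>\<^bsub>C\<^esub>
          tensor_map R W T id \<rho> (pure_tensor R W W (e v) (e (u @ z))))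
        = (\<Oplus>\<^bsub>C\<^esub>q\<in>(case p of (u, a, v, b, z) \<Rightarrow> splittings (u @ z)). right_term p q)"
      unfolding p prod.case pure[OF e_closed[OF mem(2)] e_closed[OF mem(1)]] id_apply
        linear_comult[OF lin2 mem(1)] right_term_def pure_tensor3_def ..
  qed
  also have "\<dots> = (\<Oplus>\<^bsub>C\<^esub>p\<in>Sigma (splittings w) (\<lambda>(u, a, v, b, z). splittings (u @ z)). case_prod right_term p)"
    using right_term_closed[OF w]
    by (intro C.finsum_Sigma) (auto simp: finite_splittings Pi_iff split: prod.splits)
  finally show ?thesis .
qed

private lemma comult_left:
  assumes w: "w \<in> lists \<A>"
  shows "tensor_assoc R W (tensor_map R T W \<rho> id (\<rho> (e w))) =
    (\<Oplus>\<^bsub>C\<^esub>p\<in>Sigma (splittings w) (\<lambda>(u, a, v, b, z). splittings v). case_prod left_term p)"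
proof -
  note lin = linear_maps_comp[OF
      tensor_map_linear[OF W W T.module_axioms W word_comult_linear linear_maps_id] tensor_assoc_linear[OF W]]
  note pure = tensor_map_pure_tensor[OF W W T.module_axioms W word_comult_linear linear_maps_id]
  have "tensor_assoc R W (tensor_map R T W \<rho> id (\<rho> (e w))) =
    (\<Oplus>\<^bsub>C\<^esub>p\<in>splittings w. \<Oplus>\<^bsub>C\<^esub>q\<in>(case p of (u, a, v, b, z) \<Rightarrow> splittings v). left_term p q)"
    unfolding linear_comult[OF lin w]
  proof (rule C.finsum_cong'[OF refl])
    show "(\<lambda>p. \<Oplus>\<^bsub>C\<^esub>q\<in>(case p of (u, a, v, b, z) \<Rightarrow> splittings v). left_term p q)
        \<in> splittings w \<rightarrow> carrier C"
      by (intro funcsetI C.finsum_closed) (use left_term_closed[OF w] in \<open>force simp: Pi_iff\<close>)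
    fix p assume "p \<in> splittings w"
    then obtain u a v b z where p: "p = (u, a, v, b, z)" and "w = u @ a # v @ b # z"
      by (cases p) (simp add: splittings_def)
    with w have mem: "u @ z \<in> lists \<A>" "v \<in> lists \<A>" "a \<in> \<A>" "b \<in> \<A>" by simp_all
    \<comment> \<open>Reassociation is also made part of the linear map; it can be evaluated once
      the second cut has produced pure tensors.\<close>
    have lin2: "(\<lambda>t. \<mu> (a, b) \<odot>\<^bsub>C\<^esub> tensor_assoc R W (pure_tensor R T W t (e (u @ z)))) \<in> linear_maps R T C"
      by (intro linear_maps_smult C.module_axioms mu_closed mem e_closed
          linear_maps_comp[OF bilinear_mapsD(1)[OF pure_tensor_bilinear[OF T.module_axioms W]] tensor_assoc_linear[OF W]])
    show "(case p of (u, a, v, b, z) \<Rightarrow> \<mu> (a, b) \<odot>\<^bsub>C\<^esub>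
          tensor_assoc R W (tensor_map R T W \<rho> id (pure_tensor R W W (e v) (e (u @ z)))))
        = (\<Oplus>\<^bsub>C\<^esub>q\<in>(case p of (u, a, v, b, z) \<Rightarrow> splittings v). left_term p q)"
      unfolding p prod.case pure[OF e_closed[OF mem(2)] e_closed[OF mem(1)]] id_apply
        linear_comult[OF lin2 mem(2)]
    proof (rule C.finsum_cong'[OF refl])
      show "left_term (u, a, v, b, z) \<in> splittings v \<rightarrow> carrier C"
        using left_term_closed[OF w] \<open>p \<in> splittings w\<close> by (force simp: p Pi_iff)
      fix q assume "q \<in> splittings v"
      then obtain x c y d z' where q: "q = (x, c, y, d, z')" and "v = x @ c # y @ d # z'"
        by (cases q) (simp add: splittings_def)
      with mem(2) have "y \<in> lists \<A>" "x @ z' \<in> lists \<A>" by simp_all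
      then show "(case q of (x, c, y, d, z') \<Rightarrow> \<mu> (c, d) \<odot>\<^bsub>C\<^esub> (\<mu> (a, b) \<odot>\<^bsub>C\<^esub>
            tensor_assoc R W (pure_tensor R T W (pure_tensor R W W (e y) (e (x @ z'))) (e (u @ z)))))
          = left_term (u, a, v, b, z) q"
        unfolding q prod.case left_term_def
        by (simp only: tensor_assoc_pure_tensor[OF W] e_closed mem(1))
    qed
  qed
  also have "\<dots> = (\<Oplus>\<^bsub>C\<^esub>p\<in>Sigma (splittings w) (\<lambda>(u, a, v, b, z). splittings v). case_prod left_term p)"
    using left_term_closed[OF w]
    by (intro C.finsum_Sigma) (auto simp: finite_splittings Pi_iff split: prod.splits)
  finally show ?thesis .
qed

text \<open>The two closure statements are recorded because linear maps and congruences can be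
  applied to the sums only with them.\<close>

private lemma coassociator_basis_vector:
  assumes w: "w \<in> lists \<A>"
  shows "coassociator R W \<rho> (e w) =
    (\<Oplus>\<^bsub>C\<^esub>p\<in>disjoint_splittings w. case_prod right_term (right_first p)) \<oplus>\<^bsub>C\<^esub>
    (\<Oplus>\<^bsub>C\<^esub>p\<in>disjoint_splittings w. case_prod right_term (left_first p))"
    and "(\<lambda>p. case_prod right_term (right_first p)) \<in> disjoint_splittings w \<rightarrow> carrier C"
    and "(\<lambda>p. case_prod right_term (left_first p)) \<in> disjoint_splittings w \<rightarrow> carrier C"
proof -
  let ?D = "disjoint_splittings w" and ?N = "nested_splittings w"
  have cl: "case_prod right_term \<in> right_first ` ?D \<rightarrow> carrier C"
    "case_prod right_term \<in> left_first ` ?D \<rightarrow> carrier C"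
    "case_prod right_term \<in> inner_first ` ?N \<rightarrow> carrier C"
    "case_prod left_term \<in> outer_first ` ?N \<rightarrow> carrier C"
    using right_term_closed[OF w] left_term_closed[OF w]
    unfolding two_step_images outer_first_image Pi_iff ball_Un
    by - (elim conjE, assumption)+
  show cl1: "(\<lambda>p. case_prod right_term (right_first p)) \<in> ?D \<rightarrow> carrier C"
    and cl2: "(\<lambda>p. case_prod right_term (left_first p)) \<in> ?D \<rightarrow> carrier C"
    using cl(1,2) by (simp_all only: Pi_iff ball_simps)
  have cl3: "(\<lambda>p. case_prod left_term (outer_first p)) \<in> ?N \<rightarrow> carrier C"
    using cl(4) by (simp only: Pi_iff ball_simps)
  note inj = inj_on_subset[OF _ subset_UNIV]
  define x where "x = (\<Oplus>\<^bsub>C\<^esub>p\<in>?D. case_prod right_term (right_first p))"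
  define y where "y = (\<Oplus>\<^bsub>C\<^esub>p\<in>?D. case_prod right_term (left_first p))"
  define n where "n = (\<Oplus>\<^bsub>C\<^esub>p\<in>?N. case_prod left_term (outer_first p))"
  \<comment> \<open>With the inner or the outer factor cut first, the tensor is \<open>v\<close>
    \<otimes> \<open>s @ t\<close> \<otimes> \<open>x @ z\<close>; only the nesting of the two
    scalars differs.\<close>
  have inner: "case_prod right_term (inner_first p) = case_prod left_term (outer_first p)"
    if pN: "p \<in> ?N" for p
  proof -
    obtain x c s a v b t d z where p: "p = (x, c, s, a, v, b, t, d, z)" and "w = x @ c # s @ a # v @ b # t @ d # z"
      using pN by (auto simp: nested_splittings_def)
    with w show ?thesis
      unfolding p inner_first_def outer_first_def right_term_def left_term_def prod.case
      by (intro smult_commute pure_tensor3_closed[OF W] e_closed) simp_all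
  qed
  note fin = finite_imageI[OF finite_disjoint_splittings] finite_imageI[OF finite_nested_splittings]
  have cl12: "case_prod right_term \<in> right_first ` ?D \<union> left_first ` ?D \<rightarrow> carrier C"
    using cl(1,2) by (simp only: Pi_iff ball_Un)
  have "tensor_map R W T id \<rho> (\<rho> (e w)) = x \<oplus>\<^bsub>C\<^esub> y \<oplus>\<^bsub>C\<^esub>
      (\<Oplus>\<^bsub>C\<^esub>p\<in>inner_first ` ?N. case_prod right_term p)"
    unfolding comult_right[OF w] two_step_images x_def y_def
      C.finsum_Un_disjoint[OF finite_UnI[OF fin(1) fin(1)] fin(2) two_step_images_disjoint(1) cl12 cl(3)]
      C.finsum_Un_disjoint[OF fin(1) fin(1) two_step_images_disjoint(2) cl(1,2)]
      C.finsum_reindex[OF cl(1) inj[OF right_first_inj]]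
      C.finsum_reindex[OF cl(2) inj[OF left_first_inj]] ..
  also have "(\<Oplus>\<^bsub>C\<^esub>p\<in>inner_first ` ?N. case_prod right_term p) = n"
    unfolding n_def C.finsum_reindex[OF cl(3) inj[OF inner_first_inj]]
    by (rule C.finsum_cong'[OF refl cl3 inner])
  also have "n = tensor_assoc R W (tensor_map R T W \<rho> id (\<rho> (e w)))"
    unfolding n_def comult_left[OF w] outer_first_image[symmetric]
      C.finsum_reindex[OF cl(4) inj[OF outer_first_inj]] ..
  finally have "coassociator R W \<rho> (e w) = x \<oplus>\<^bsub>C\<^esub> y \<oplus>\<^bsub>C\<^esub> n \<ominus>\<^bsub>C\<^esub> n"
    by (simp only: coassociator_def n_def comult_left[OF w] outer_first_image[symmetric]
      C.finsum_reindex[OF cl(4) inj[OF outer_first_inj]])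
  moreover have "x \<in> carrier C" "y \<in> carrier C" "n \<in> carrier C"
    unfolding x_def y_def n_def by (intro C.finsum_closed cl1 cl2 cl3)+
  ultimately show "coassociator R W \<rho> (e w) = x \<oplus>\<^bsub>C\<^esub> y"
    by (simp add: a_minus_def C.M.a_assoc C.M.r_neg)
qed

text \<open>Either order of cuts leaves the words \<open>x\<close>, \<open>s\<close>,
  \<open>z\<close> joined, as \<open>x @ (s @ z)\<close> or \<open>(x @ s) @ z\<close>. The tensors
  differ only in the order of the cut factors \<open>v\<close> and \<open>y\<close>, and the scalars
  commute.\<close>

private lemma swap_terms:
  assumes w: "w \<in> lists \<A>" and "p \<in> disjoint_splittings w"
  shows "tensor_swap12 R W (case_prod right_term (right_first p)) = case_prod right_term (left_first p)"
    and "tensor_swap12 R W (case_prod right_term (left_first p)) = case_prod right_term (right_first p)"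
proof -
  obtain x c y d s a v b z where p: "p = (x, c, y, d, s, a, v, b, z)" and "w = x @ c # y @ d # s @ a # v @ b # z"
    using assms(2) by (auto simp: disjoint_splittings_def)
  with w have mem: "a \<in> \<A>" "b \<in> \<A>" "c \<in> \<A>" "d \<in> \<A>" "v \<in> lists \<A>" "y \<in> lists \<A>" "x @ s @ z \<in> lists \<A>"
    by simp_all
  note sw = linear_mapsD(3)[OF tensor_swap12_linear[OF W]]
  note cl = mem mu_closed e_closed pure_tensor3_closed[OF W] C.smult_closed
  have "tensor_swap12 R W (\<mu> (c, d) \<odot>\<^bsub>C\<^esub> (\<mu> (a, b) \<odot>\<^bsub>C\<^esub> pure_tensor3 R W (e v) (e y) (e (x @ s @ z))))
      = \<mu> (a, b) \<odot>\<^bsub>C\<^esub> (\<mu> (c, d) \<odot>\<^bsub>C\<^esub> pure_tensor3 R W (e y) (e v) (e (x @ s @ z)))"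
    by (simp only: sw cl tensor_swap12_pure_tensor3[OF W] smult_commute[of a b c d])
  moreover have "tensor_swap12 R W (\<mu> (a, b) \<odot>\<^bsub>C\<^esub> (\<mu> (c, d) \<odot>\<^bsub>C\<^esub> pure_tensor3 R W (e y) (e v) (e (x @ s @ z))))
      = \<mu> (c, d) \<odot>\<^bsub>C\<^esub> (\<mu> (a, b) \<odot>\<^bsub>C\<^esub> pure_tensor3 R W (e v) (e y) (e (x @ s @ z)))"
    by (simp only: sw cl tensor_swap12_pure_tensor3[OF W] smult_commute[of c d a b])
  ultimately show "tensor_swap12 R W (case_prod right_term (right_first p)) = case_prod right_term (left_first p)"
    and "tensor_swap12 R W (case_prod right_term (left_first p)) = case_prod right_term (right_first p)"
    unfolding p right_first_def left_first_def right_term_def prod.case append_assoc .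
qed

text \<open>The exchange maps each of the two remaining sums termwise onto the other, so their total
  is fixed.\<close>

private lemma swap_coassociator_basis_vector:
  assumes w: "w \<in> lists \<A>"
  shows "tensor_swap12 R W (coassociator R W \<rho> (e w)) = coassociator R W \<rho> (e w)"
proof -
  let ?D = "disjoint_splittings w"
  let ?r = "\<lambda>p. case_prod right_term (right_first p)" and ?l = "\<lambda>p. case_prod right_term (left_first p)"
  note co = coassociator_basis_vector[OF w]
  note lin = tensor_swap12_linear[OF W]
  note sum = linear_maps_finsum[OF C.module_axioms C.module_axioms lin]
  have rc: "finsum C ?r ?D \<in> carrier C" and lc: "finsum C ?l ?D \<in> carrier C"
    by (intro C.finsum_closed co)+
  have "tensor_swap12 R W (finsum C ?r ?D) = finsum C ?l ?D"
    unfolding sum[OF co(2)] by (rule C.finsum_cong'[OF refl co(3) swap_terms(1)[OF w]])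
  moreover have "tensor_swap12 R W (finsum C ?l ?D) = finsum C ?r ?D"
    unfolding sum[OF co(3)] by (rule C.finsum_cong'[OF refl co(2) swap_terms(2)[OF w]])
  ultimately show ?thesis
    unfolding co(1) linear_mapsD(2)[OF lin rc lc] using C.M.a_comm[OF rc lc] by simp
qed

lemma word_comult_pre_lie: "pre_lie_comultiplication R W \<rho>"
proof (intro pre_lie_comultiplication.intro comultiplication.intro W
    comultiplication_axioms.intro pre_lie_comultiplication_axioms.intro word_comult_linear)
  fix a assume a: "a \<in> carrier W"
  note lin = coassociator_linear[OF W word_comult_linear]
  show "tensor_swap12 R W (coassociator R W \<rho> a) = coassociator R W \<rho> a"
    \<comment> \<open>Both sides are linear in \<open>a\<close>, so agreement on the basis of words
      is enough.\<close>
    by (rule linear_maps_eqI_basis[where X = "lists \<A>", folded word_module_def,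
          OF C.module_axioms linear_maps_comp[OF lin tensor_swap12_linear[OF W]] lin
            swap_coassociator_basis_vector a])
qed

end

theorem theorem5p1p1:
  fixes R :: "('r, 's) ring_scheme"
    and \<A> :: "'a set"
    and \<mu> :: "'a \<times> 'a \<Rightarrow> 'r"
  assumes "cring R"
    and "\<mu> \<in> \<A> \<times> \<A> \<rightarrow> carrier R"
  shows "pre_lie_comultiplication R (word_module R \<A>) (word_comult R \<A> \<mu>)"
  by (rule word_comult_pre_lie[OF assms])

end
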